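(* Let $K$ be a countable algebraically closed field and let $Q'$ be a quiver containing, for some vertex $v$, a subquiver of one of the following two types: (i) an oriented cycle $v=u_0\to u_1\to\cdots\to u_k\to u_0$ through $v$; or (ii) an infinite sequence of distinct vertices $v=v_0,v_1,v_2,\dots$ with arrows $v_{n+1}\to v_n$ for all $n\in\omega$; and suppose that the set of all paths in $Q'$ ending in $v$ is countable. Then $\mathsf{UP}$ implies that the following assertion fails: for every $KQ'$-module $M$, if $\mathrm{Ext}^n_{KQ'}(M,KQ')=0$ for all $n\geq1$, then $M$ is projective.
   Context: A quiver is a directed graph; paths are finite sequences of composable arrows, with trivial paths $e_u$ at each vertex $u$. The path algebra $KQ'$ has as $K$-basis all paths of $Q'$, with product of two paths being their concatenation when the target of the first equals the source of the second, and $0$ otherwise; it need not have an identity. Modules are right modules, and a module $P$ is projective if every epimorphism onto $P$ splits. $\omega_1$ is the first uncountable ordinal and $\mathrm{Lim}$ is the class of nonzero limit ordinals. A ladder system is a sequence $\langle C_\alpha:\alpha\in\omega_1\cap\mathrm{Lim}\rangle$ where each $C_\alpha=\{\zeta^\alpha_n:n\in\omega\}$ is a cofinal subset of $\alpha$ of order type $\omega$, enumerated increasingly. A coloring of it is a sequence $\langle d_\alpha\rangle$ of functions with $\mathrm{dom}(d_\alpha)=C_\alpha$. A function $f$ with domain $\omega_1$ uniformizes the coloring if for every $\alpha$ there is $N\in\omega$ with $f(\zeta^\alpha_n)=d_\alpha(\zeta^\alpha_n)$ for all $n\geq N$. $\mathsf{UP}$ is the assertion: for any sequence $\langle X_\beta:\beta<\omega_1\rangle$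 of countable sets and any coloring $\langle d_\alpha\rangle$ of any ladder system with $d_\alpha(\zeta^\alpha_n)\in X_{\zeta^\alpha_n}$ for all $\alpha,n$, there is a function with domain $\omega_1$ uniformizing the coloring. *)

theory Defs
  imports "HOL-Computational_Algebra.Polynomial" "HOL-Library.Countable_Set"
begin

text \<open>A quiver is given by a vertex type 'v, an arrow type 'e and source/target maps.
  A path is represented as a pair (u, es): a start vertex u and a list es of composable
  arrows starting at u; (u, []) is the trivial path e_u.\<close>

fun qwalk :: "('e \<Rightarrow> 'v) \<Rightarrow> ('e \<Rightarrow> 'v) \<Rightarrow> 'v \<Rightarrow> 'e list \<Rightarrow> bool" where
  "qwalk src tgt u [] = True"
| "qwalk src tgt u (e # es) = (src e = u \<and> qwalk src tgt (tgt e) es)"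

fun qend :: "('e \<Rightarrow> 'v) \<Rightarrow> 'v \<Rightarrow> 'e list \<Rightarrow> 'v" where
  "qend tgt u [] = u"
| "qend tgt u (e # es) = qend tgt (tgt e) es"

definition is_qpath :: "('e \<Rightarrow> 'v) \<Rightarrow> ('e \<Rightarrow> 'v) \<Rightarrow> 'v \<times> 'e list \<Rightarrow> bool" where
  "is_qpath src tgt p = qwalk src tgt (fst p) (snd p)"

definition paths_ending_in :: "('e \<Rightarrow> 'v) \<Rightarrow> ('e \<Rightarrow> 'v) \<Rightarrow> 'v \<Rightarrow> ('v \<times> 'e list) set" where
  "paths_ending_in src tgt v = {p. is_qpath src tgt p \<and> qend tgt (fst p) (snd p) = v}"

definition has_oriented_cycle_through :: "('e \<Rightarrow> 'v) \<Rightarrow> ('e \<Rightarrow> 'v) \<Rightarrow> 'v \<Rightarrow> bool" where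
  "has_oriented_cycle_through src tgt v \<longleftrightarrow>
     (\<exists>es. es \<noteq> [] \<and> qwalk src tgt v es \<and> qend tgt v es = v \<and> distinct (map src es))"

definition has_incoming_ray_at :: "('e \<Rightarrow> 'v) \<Rightarrow> ('e \<Rightarrow> 'v) \<Rightarrow> 'v \<Rightarrow> bool" where
  "has_incoming_ray_at src tgt v \<longleftrightarrow>
     (\<exists>w :: nat \<Rightarrow> 'v. \<exists>a :: nat \<Rightarrow> 'e. w 0 = v \<and> inj w \<and>
        (\<forall>n. src (a n) = w (Suc n) \<and> tgt (a n) = w n))"

record 'r ralg =
  rcar :: "'r set"
  radd :: "'r \<Rightarrow> 'r \<Rightarrow> 'r"
  rzero :: 'r
  rmul :: "'r \<Rightarrow> 'r \<Rightarrow> 'r"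

text \<open>The path algebra KQ': finitely supported K-valued functions on the paths of Q';
  the product of two paths is their concatenation if composable and 0 otherwise.\<close>
definition path_algebra :: "('e \<Rightarrow> 'v) \<Rightarrow> ('e \<Rightarrow> 'v) \<Rightarrow> ('v \<times> 'e list \<Rightarrow> 'k::field) ralg" where
  "path_algebra src tgt =
    \<lparr> rcar = {f. finite {p. f p \<noteq> 0} \<and> (\<forall>p. f p \<noteq> 0 \<longrightarrow> is_qpath src tgt p)},
      radd = (\<lambda>f g p. f p + g p),
      rzero = (\<lambda>p. 0),
      rmul = (\<lambda>f g p. if is_qpath src tgt p then
                 (\<Sum>i\<le>length (snd p). f (fst p, take i (snd p)) *
                      g (qend tgt (fst p) (take i (snd p)), drop i (snd p)))
               else 0) \<rparr>"

record ('m, 'r) rmod =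
  mcar :: "'m set"
  madd :: "'m \<Rightarrow> 'm \<Rightarrow> 'm"
  mzero :: 'm
  mact :: "'m \<Rightarrow> 'r \<Rightarrow> 'm"

definition msum :: "('m, 'r) rmod \<Rightarrow> ('m \<times> 'r) list \<Rightarrow> 'm" where
  "msum M xs = foldr (\<lambda>(y, r) acc. madd M (mact M y r) acc) xs (mzero M)"

definition rmodule :: "'r ralg \<Rightarrow> ('m, 'r) rmod \<Rightarrow> bool" where
  "rmodule A M \<longleftrightarrow>
     mzero M \<in> mcar M \<and>
     (\<forall>x\<in>mcar M. \<forall>y\<in>mcar M. madd M x y \<in> mcar M) \<and>
     (\<forall>x\<in>mcar M. \<forall>r\<in>rcar A. mact M x r \<in> mcar M) \<and>
     (\<forall>x\<in>mcar M. \<forall>y\<in>mcar M. \<forall>z\<in>mcar M. madd M (madd M x y) z = madd M x (madd M y z)) \<and>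
     (\<forall>x\<in>mcar M. \<forall>y\<in>mcar M. madd M x y = madd M y x) \<and>
     (\<forall>x\<in>mcar M. madd M (mzero M) x = x) \<and>
     (\<forall>x\<in>mcar M. \<exists>y\<in>mcar M. madd M x y = mzero M) \<and>
     (\<forall>x\<in>mcar M. \<forall>r\<in>rcar A. \<forall>s\<in>rcar A. mact M x (radd A r s) = madd M (mact M x r) (mact M x s)) \<and>
     (\<forall>x\<in>mcar M. \<forall>y\<in>mcar M. \<forall>r\<in>rcar A. mact M (madd M x y) r = madd M (mact M x r) (mact M y r)) \<and>
     (\<forall>x\<in>mcar M. \<forall>r\<in>rcar A. \<forall>s\<in>rcar A. mact M (mact M x r) s = mact M x (rmul A r s)) \<and>
     (\<forall>x\<in>mcar M. \<exists>xs. set xs \<subseteq> mcar M \<times> rcar A \<and> x = msum M xs)"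

definition regular_module :: "'r ralg \<Rightarrow> ('r, 'r) rmod" where
  "regular_module A = \<lparr> mcar = rcar A, madd = radd A, mzero = rzero A, mact = rmul A \<rparr>"

definition mhom :: "'r ralg \<Rightarrow> ('m, 'r) rmod \<Rightarrow> ('n, 'r) rmod \<Rightarrow> ('m \<Rightarrow> 'n) \<Rightarrow> bool" where
  "mhom A M N f \<longleftrightarrow>
     (\<forall>x\<in>mcar M. f x \<in> mcar N) \<and>
     (\<forall>x\<in>mcar M. \<forall>y\<in>mcar M. f (madd M x y) = madd N (f x) (f y)) \<and>
     (\<forall>x\<in>mcar M. \<forall>r\<in>rcar A. f (mact M x r) = mact N (f x) r)"

text \<open>P is projective: every epimorphism onto P splits.  The source modules N range over
  modules whose carrier lies in the type 'm => 'r, which is large enough to contain the free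
  module on the carrier of P (finitely supported functions from the carrier of P to A), so this
  is the usual notion.\<close>
definition projective :: "'r ralg \<Rightarrow> ('m, 'r) rmod \<Rightarrow> bool" where
  "projective A P \<longleftrightarrow> rmodule A P \<and>
     (\<forall>(N :: ('m \<Rightarrow> 'r, 'r) rmod) f.
        rmodule A N \<and> mhom A N P f \<and> f ` mcar N = mcar P \<longrightarrow>
        (\<exists>g. mhom A P N g \<and> (\<forall>x\<in>mcar P. f (g x) = x)))"

definition proj_resolution ::
  "'r ralg \<Rightarrow> ('m, 'r) rmod \<Rightarrow> (nat \<Rightarrow> ('m, 'r) rmod) \<Rightarrow> (nat \<Rightarrow> 'm \<Rightarrow> 'm) \<Rightarrow> ('m \<Rightarrow> 'm) \<Rightarrow> bool" where
  "proj_resolution A M P d eps \<longleftrightarrow>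
     (\<forall>i. projective A (P i)) \<and>
     mhom A (P 0) M eps \<and> eps ` mcar (P 0) = mcar M \<and>
     (\<forall>i. mhom A (P (Suc i)) (P i) (d i)) \<and>
     {x\<in>mcar (P 0). eps x = mzero M} = d 0 ` mcar (P 1) \<and>
     (\<forall>i. {x\<in>mcar (P (Suc i)). d i x = mzero (P i)} = d (Suc i) ` mcar (P (Suc (Suc i))))"

text \<open>Ext^n_A(M,N) = 0 for all n >= 1: computed as the cohomology of Hom_A(P_*, N) for a
  projective resolution P_* of M.  (By the comparison theorem this does not depend on the
  resolution; resolutions are taken with carriers in the type of M.)\<close>
definition Ext_vanish :: "'r ralg \<Rightarrow> ('m, 'r) rmod \<Rightarrow> ('n, 'r) rmod \<Rightarrow> bool" where
  "Ext_vanish A M N \<longleftrightarrow>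
     (\<exists>P d eps. proj_resolution A M P d eps \<and>
        (\<forall>n\<ge>1. \<forall>\<phi>. mhom A (P n) N \<phi> \<and> (\<forall>x\<in>mcar (P (Suc n)). \<phi> (d n x) = mzero N) \<longrightarrow>
           (\<exists>\<psi>. mhom A (P (n - 1)) N \<psi> \<and> (\<forall>x\<in>mcar (P n). \<phi> x = \<psi> (d (n - 1) x)))))"

text \<open>omega_1 is represented by the well-order cardSuc natLeq (the successor cardinal of
  aleph_0, an initial well-order of type omega_1 on a set of type nat set).\<close>
abbreviation omega1 :: "nat set rel" where
  "omega1 \<equiv> cardSuc natLeq"

definition olt :: "nat set \<Rightarrow> nat set \<Rightarrow> bool" where
  "olt a b \<longleftrightarrow> (a, b) \<in> omega1 \<and> a \<noteq> b"

definition is_limit :: "nat set \<Rightarrow> bool" where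
  "is_limit \<alpha> \<longleftrightarrow> \<alpha> \<in> Field omega1 \<and> (\<exists>\<beta>. olt \<beta> \<alpha>) \<and>
     (\<forall>\<beta>. olt \<beta> \<alpha> \<longrightarrow> (\<exists>\<gamma>. olt \<beta> \<gamma> \<and> olt \<gamma> \<alpha>))"

text \<open>A ladder system, given by the increasing enumerations zeta alpha n of the sets C_alpha.\<close>
definition ladder_system :: "(nat set \<Rightarrow> nat \<Rightarrow> nat set) \<Rightarrow> bool" where
  "ladder_system \<zeta> \<longleftrightarrow>
     (\<forall>\<alpha>. is_limit \<alpha> \<longrightarrow>
        (\<forall>n. olt (\<zeta> \<alpha> n) \<alpha>) \<and> (\<forall>n. olt (\<zeta> \<alpha> n) (\<zeta> \<alpha> (Suc n))) \<and>
        (\<forall>\<beta>. olt \<beta> \<alpha> \<longrightarrow> (\<exists>n. olt \<beta> (\<zeta> \<alpha> n))))"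

text \<open>UP.  Colours are natural numbers (every countable set X_beta injects into nat).\<close>
definition UP :: bool where
  "UP \<longleftrightarrow>
     (\<forall>(\<zeta> :: nat set \<Rightarrow> nat \<Rightarrow> nat set) (X :: nat set \<Rightarrow> nat set) (d :: nat set \<Rightarrow> nat set \<Rightarrow> nat).
        ladder_system \<zeta> \<and> (\<forall>\<beta>. countable (X \<beta>)) \<and>
        (\<forall>\<alpha> n. is_limit \<alpha> \<longrightarrow> d \<alpha> (\<zeta> \<alpha> n) \<in> X (\<zeta> \<alpha> n)) \<longrightarrow>
        (\<exists>f :: nat set \<Rightarrow> nat. \<forall>\<alpha>. is_limit \<alpha> \<longrightarrow>
           (\<exists>N. \<forall>n\<ge>N. f (\<zeta> \<alpha> n) = d \<alpha> (\<zeta> \<alpha> n))))"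

end

theory Submission
  imports Defs "HOL-Library.Function_Algebras" "HOL-Algebra.FiniteProduct"
begin

text \<open>
  Both types of subquiver yield vertices \<open>w n\<close> with \<open>w 0 = v\<close> and nontrivial paths \<open>p n\<close> from
  \<open>w (n + 1)\<close> to \<open>w n\<close>. Fix a ladder system \<open>\<zeta>\<close> and let \<open>M\<close> be generated by \<open>x \<beta> n\<close> and \<open>y \<alpha> n\<close>, each
  in a copy of the projective right ideal at \<open>w n\<close>, subject to the relations
  \<open>y \<alpha> n = y \<alpha> (n + 1) \<cdot> p n + x (\<zeta> \<alpha> n) n\<close> for limit \<open>\<alpha>\<close>. The relations are independent, so \<open>M\<close> has a
  projective resolution of length one.

  A homomorphism from the module of relations to the path algebra \<open>A\<close> is a choice of elements
  \<open>c \<alpha> n\<close> of the countable set \<open>A e\<close>, \<open>e\<close> the trivial path at \<open>w n\<close>. Colouring \<open>\<zeta> \<alpha> n\<close> by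
  \<open>(n, c \<alpha> n)\<close>, a uniformizing function tells where to send the \<open>x \<beta> n\<close> so that for each \<open>\<alpha>\<close> only
  finitely many relations still fail, and these are repaired by a downward recursion on the
  \<open>y \<alpha> n\<close>. Hence all Ext groups vanish.

  If \<open>M\<close> were projective, a section of the presentation would map generators below some limit
  \<open>\<delta>\<close> to elements supported below \<open>\<delta>\<close>. Modulo these, the image of \<open>y \<delta> 0\<close> is right divisible by
  arbitrarily long paths, hence zero; but \<open>y \<delta> 0\<close> does not lie in the submodule of \<open>M\<close> generated
  below \<open>\<delta>\<close>.
\<close>

section \<open>The path algebra\<close>

lemma qwalk_append:
  "qwalk src tgt u (xs @ ys) \<longleftrightarrow> qwalk src tgt u xs \<and> qwalk src tgt (qend tgt u xs) ys"
  by (induction xs arbitrary: u) auto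

lemma qend_append: "qend tgt u (xs @ ys) = qend tgt (qend tgt u xs) ys"
  by (induction xs arbitrary: u) auto

lemma qwalk_take: "qwalk src tgt u l \<Longrightarrow> qwalk src tgt u (take i l)"
  by (metis append_take_drop_id qwalk_append)

lemma qwalk_drop: "qwalk src tgt u l \<Longrightarrow> qwalk src tgt (qend tgt u (take i l)) (drop i l)"
  by (metis append_take_drop_id qwalk_append)

lemma qend_take_drop: "qend tgt (qend tgt u (take i l)) (take j (drop i l)) = qend tgt u (take (i + j) l)"
  by (simp add: take_add qend_append)

lemma path_algebra_simps [simp]:
  "radd (path_algebra src tgt) = (+)"
  "rzero (path_algebra src tgt) = 0"
  by (auto simp: path_algebra_def fun_eq_iff)

lemma path_algebra_carrier_iff:
  "f \<in> rcar (path_algebra src tgt) \<longleftrightarrow>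
     finite {p. f p \<noteq> 0} \<and> (\<forall>u l. f (u, l) \<noteq> 0 \<longrightarrow> qwalk src tgt u l)"
  by (auto simp: path_algebra_def is_qpath_def)

lemma regular_module_simps [simp]:
  "mcar (regular_module R) = rcar R" "madd (regular_module R) = radd R"
  "mzero (regular_module R) = rzero R" "mact (regular_module R) = rmul R"
  by (simp_all add: regular_module_def)

locale quiver =
  fixes src tgt :: "'e \<Rightarrow> 'v"
begin

section \<open>Multiplication in the path algebra\<close>

abbreviation PA :: "('v \<times> 'e list \<Rightarrow> 'k::field) ralg" where
  "PA \<equiv> path_algebra src tgt"

abbreviation pmul :: "('v \<times> 'e list \<Rightarrow> 'k::field) \<Rightarrow> _ \<Rightarrow> _" (infixl "\<star>" 70) where
  "f \<star> g \<equiv> rmul PA f g"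

lemma pmul_path:
  "qwalk src tgt u l \<Longrightarrow>
    (f \<star> g) (u, l) = (\<Sum>i\<le>length l. f (u, take i l) * g (qend tgt u (take i l), drop i l))"
  by (simp add: path_algebra_def is_qpath_def)

lemma pmul_not_path: "\<not> qwalk src tgt u l \<Longrightarrow> (f \<star> g) (u, l) = 0"
  by (simp add: path_algebra_def is_qpath_def)

lemma pmul_add_left: "(f + g) \<star> h = f \<star> h + g \<star> h"
  by (rule ext) (auto simp: path_algebra_def sum.distrib algebra_simps)

lemma pmul_add_right: "f \<star> (g + h) = f \<star> g + f \<star> h"
  by (rule ext) (auto simp: path_algebra_def sum.distrib algebra_simps)

lemma pmul_zero_left [simp]: "0 \<star> h = 0"
  by (rule ext) (auto simp: path_algebra_def)

lemma pmul_zero_right [simp]: "h \<star> 0 = 0"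
  by (rule ext) (auto simp: path_algebra_def)

lemma pmul_minus_left: "(- f) \<star> h = - (f \<star> h)"
  by (rule ext) (auto simp: path_algebra_def sum_negf)

lemma pmul_diff_left: "(f - g) \<star> h = f \<star> h - g \<star> h"
  using pmul_add_left[of f "- g" h] by (simp add: pmul_minus_left)

lemma pmul_nonzeroE:
  assumes "(f \<star> g) (u, l) \<noteq> 0"
  obtains l1 l2 where "l = l1 @ l2" "qwalk src tgt u l" "f (u, l1) \<noteq> 0" "g (qend tgt u l1, l2) \<noteq> 0"
proof -
  have w: "qwalk src tgt u l" using assms pmul_not_path by blast
  obtain i where "f (u, take i l) * g (qend tgt u (take i l), drop i l) \<noteq> 0"
    using assms unfolding pmul_path[OF w] by (meson sum.neutral)
  then show thesis using that[of "take i l" "drop i l"] w by auto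
qed

text \<open>Every path in the support of a product is a concatenation of a path from each factor's
  support, so finiteness is inherited.\<close>

lemma pmul_closed:
  assumes "f \<in> rcar PA" "g \<in> rcar PA"
  shows "f \<star> g \<in> rcar PA"
proof -
  have "{p. (f \<star> g) p \<noteq> 0} \<subseteq>
     (\<lambda>(p, q). (fst p, snd p @ snd q)) ` ({p. f p \<noteq> 0} \<times> {p. g p \<noteq> 0})"
    by (force elim!: pmul_nonzeroE)
  then have "finite {p. (f \<star> g) p \<noteq> 0}"
    using assms by (auto simp: path_algebra_carrier_iff intro: finite_subset)
  then show ?thesis by (auto simp: path_algebra_carrier_iff elim: pmul_nonzeroE)
qed

text \<open>Both sides sum over all ways of cutting the path into three pieces.\<close>

lemma pmul_assoc: "(f \<star> g) \<star> h = f \<star> (g \<star> h)"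
proof (rule ext, clarify)
  fix u l
  show "((f \<star> g) \<star> h) (u, l) = (f \<star> (g \<star> h)) (u, l)"
  proof (cases "qwalk src tgt u l")
    case w: True
    define n where "n = length l"
    \<comment> \<open>Here \<open>j\<close> is the first cut and \<open>i\<close> the second, with
      \<open>j\<close> at most \<open>i\<close>; below, \<open>k\<close> is the length of the middle
      piece.\<close>
    define T where "T i j = f (u, take j l) * g (qend tgt u (take j l), take (i - j) (drop j l)) *
       h (qend tgt u (take i l), drop i l)" for i j
    have "((f \<star> g) \<star> h) (u, l) = (\<Sum>i\<le>n. \<Sum>j\<le>i. T i j)"
    proof -
      have "(f \<star> g) (u, take i l) * h (qend tgt u (take i l), drop i l) = (\<Sum>j\<le>i. T i j)"
        if "i \<le> n" for i
        using that unfolding pmul_path[OF qwalk_take[OF w]] sum_distrib_right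
        by (intro sum.cong) (auto simp: n_def T_def min_def drop_take)
      then show ?thesis unfolding pmul_path[OF w] n_def[symmetric] by simp
    qed
    also have "\<dots> = (\<Sum>j\<le>n. \<Sum>k\<le>n - j. T (j + k) j)"
      unfolding sum.Sigma[OF finite_atMost ballI[OF finite_atMost]]
      by (rule sum.reindex_bij_witness[where i = "\<lambda>(j, k). (j + k, j)" and j = "\<lambda>(i, j). (j, i - j)"]) auto
    also have "\<dots> = (f \<star> (g \<star> h)) (u, l)"
    proof -
      have "f (u, take j l) * (g \<star> h) (qend tgt u (take j l), drop j l) = (\<Sum>k\<le>n - j. T (j + k) j)" for j
        unfolding pmul_path[OF qwalk_drop[OF w]] sum_distrib_left
        by (intro sum.cong) (auto simp: n_def T_def qend_take_drop ac_simps)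
      then show ?thesis unfolding pmul_path[OF w] n_def[symmetric] by simp
    qed
    finally show ?thesis .
  qed (simp add: pmul_not_path)
qed

section \<open>Paths as elements of the algebra, and the right ideals at vertices\<close>

definition pbasis :: "'v \<Rightarrow> 'e list \<Rightarrow> 'v \<times> 'e list \<Rightarrow> 'k::field" where
  "pbasis u l = (\<lambda>p. if p = (u, l) then 1 else 0)"

text \<open>The right ideal generated by the trivial path at \<open>u\<close>.\<close>
definition ideal_at :: "'v \<Rightarrow> ('v \<times> 'e list \<Rightarrow> 'k::field) set" where
  "ideal_at u = {f \<in> rcar PA. \<forall>p. f p \<noteq> 0 \<longrightarrow> fst p = u}"

lemma carrier_add: "f \<in> rcar PA \<Longrightarrow> g \<in> rcar PA \<Longrightarrow> f + g \<in> rcar PA"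
  unfolding path_algebra_carrier_iff
  by (auto intro: finite_subset[of _ "{p. f p \<noteq> 0} \<union> {p. g p \<noteq> 0}"])
    (metis add.right_neutral)

lemma carrier_minus: "f \<in> rcar PA \<Longrightarrow> - f \<in> rcar PA"
  by (auto simp: path_algebra_carrier_iff)

text \<open>This set is the left ideal \<open>A e\<close> for the trivial path \<open>e\<close> at
  \<open>v\<close>. An element is determined by its graph over its support, which is a finite subset
  of a countable set.\<close>

lemma countable_left_ideal:
  assumes "countable (UNIV :: 'k::field set)" "countable (paths_ending_in src tgt v)"
  shows "countable {f :: 'v \<times> 'e list \<Rightarrow> 'k. f \<in> rcar PA \<and> (\<forall>u l. f (u, l) \<noteq> 0 \<longrightarrow> qend tgt u l = v)}"
    (is "countable ?L")
proof -
  define graph where "graph f = {(p, f p) |p. f p \<noteq> 0}" for f :: "'v \<times> 'e list \<Rightarrow> 'k"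
  have "graph f = (\<lambda>p. (p, f p)) ` {p. f p \<noteq> 0}" for f by (auto simp: graph_def)
  then have "graph ` ?L \<subseteq> {A. finite A \<and> A \<subseteq> paths_ending_in src tgt v \<times> UNIV}"
    by (auto simp: path_algebra_carrier_iff paths_ending_in_def is_qpath_def)
  moreover have "countable {A. finite A \<and> A \<subseteq> paths_ending_in src tgt v \<times> (UNIV :: 'k set)}"
    using assms by (intro countable_Collect_finite_subset) simp
  ultimately have "countable (graph ` ?L)" by (rule countable_subset)
  moreover have "inj_on graph ?L"
  proof (rule inj_onI, rule ext, rule ccontr)
    fix f g p assume "graph f = graph g" "f p \<noteq> g p"
    moreover have "(p, a) \<in> graph h \<longleftrightarrow> a = h p \<and> h p \<noteq> 0" for a h
      by (cases p) (auto simp: graph_def)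
    ultimately show False by metis
  qed
  ultimately show ?thesis by (rule countable_image_inj_on)
qed

lemma carrier_zero [simp]: "0 \<in> rcar PA"
  by (auto simp: path_algebra_carrier_iff)

lemma ideal_at_carrier: "f \<in> ideal_at u \<Longrightarrow> f \<in> rcar PA"
  by (simp add: ideal_at_def)

lemma ideal_at_zero [simp]: "0 \<in> ideal_at u"
  by (simp add: ideal_at_def)

lemma ideal_at_add: "f \<in> ideal_at u \<Longrightarrow> g \<in> ideal_at u \<Longrightarrow> f + g \<in> ideal_at u"
  by (auto simp: ideal_at_def carrier_add) (metis add.right_neutral fst_conv)

lemma ideal_at_minus: "f \<in> ideal_at u \<Longrightarrow> - f \<in> ideal_at u"
  by (auto simp: ideal_at_def carrier_minus)

lemma ideal_at_mult: "f \<in> ideal_at u \<Longrightarrow> g \<in> rcar PA \<Longrightarrow> f \<star> g \<in> ideal_at u"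
  by (auto simp: ideal_at_def pmul_closed elim!: pmul_nonzeroE)

lemma pbasis_ideal_at: "qwalk src tgt u l \<Longrightarrow> pbasis u l \<in> ideal_at u"
  by (auto simp: ideal_at_def pbasis_def path_algebra_carrier_iff)

text \<open>Among all cuts of the concatenated path, only the one directly after \<open>l\<close>
  meets the support of \<open>pbasis u l\<close>.\<close>

lemma pbasis_mult_apply:
  assumes "qwalk src tgt u (l @ l')"
  shows "(pbasis u l \<star> g) (u, l @ l') = g (qend tgt u l, l')"
proof -
  have "(pbasis u l \<star> g) (u, l @ l') =
     (\<Sum>i\<le>length (l @ l'). if i = length l then g (qend tgt u l, l') else 0)"
    unfolding pmul_path[OF assms]
    by (rule sum.cong) (auto simp: pbasis_def dest: arg_cong[of _ _ length])
  then show ?thesis by simp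
qed

text \<open>The algebra may lack an identity, but each vertex ideal has this left identity, and
  hence a single generator.\<close>

lemma pbasis_Nil_mult:
  assumes "g \<in> ideal_at u"
  shows "pbasis u [] \<star> g = g"
proof (rule ext, clarify)
  fix u' l
  show "(pbasis u [] \<star> g) (u', l) = g (u', l)"
  proof (cases "u' = u \<and> qwalk src tgt u l")
    case True
    then show ?thesis using pbasis_mult_apply[of u "[]" l g] by simp
  next
    case False
    then have "g (u', l) = 0" using assms by (auto simp: ideal_at_def path_algebra_carrier_iff)
    moreover have "(pbasis u [] \<star> g) (u', l) = 0"
      using False by (auto simp: pbasis_def split: if_splits elim!: pmul_nonzeroE intro: ccontr)
    ultimately show ?thesis by simp
  qed
qed

lemma pbasis_mult_unit:
  assumes "qwalk src tgt u l"
  shows "pbasis u l \<star> pbasis (qend tgt u l) [] = pbasis u l"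
proof (rule ext, clarify)
  fix u' l'
  show "(pbasis u l \<star> pbasis (qend tgt u l) []) (u', l') = pbasis u l (u', l')"
  proof (cases "u' = u \<and> l' = l")
    case True
    then show ?thesis
      using pbasis_mult_apply[of u l "[]" "pbasis (qend tgt u l) []"] assms by (simp add: pbasis_def)
  next
    case False
    then have "(pbasis u l \<star> pbasis (qend tgt u l) []) (u', l') = 0"
      by (auto simp: pbasis_def split: if_splits elim!: pmul_nonzeroE intro: ccontr)
    then show ?thesis using False by (auto simp: pbasis_def)
  qed
qed

text \<open>Prefixing \<open>l\<close> to a path in the support of \<open>g\<close> gives a path at
  which the product has the same coefficient, so nothing cancels.\<close>

lemma pbasis_mult_nonzero:
  assumes "g \<in> ideal_at (qend tgt u l)" "qwalk src tgt u l" "g \<noteq> 0"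
  shows "pbasis u l \<star> g \<noteq> 0"
proof -
  obtain l' where l': "g (qend tgt u l, l') \<noteq> 0"
    using assms(1,3) by (force simp: ideal_at_def fun_eq_iff)
  then have "qwalk src tgt u (l @ l')"
    using assms by (auto simp: ideal_at_def path_algebra_carrier_iff qwalk_append)
  then show ?thesis using l' pbasis_mult_apply by (metis zero_fun_apply)
qed

lemma mult_pbasis_Nil_end:
  assumes "(f \<star> pbasis u []) (u', l) \<noteq> 0"
  shows "qend tgt u' l = u"
  using assms by (auto simp: pbasis_def split: if_splits elim!: pmul_nonzeroE)

text \<open>Right multiplication by a nontrivial path lengthens every path in the support. Iterated,
  this forces elements divisible by arbitrarily long paths to vanish.\<close>

lemma mult_pbasis_length:
  assumes "\<And>p. f p \<noteq> 0 \<Longrightarrow> n \<le> length (snd p)" "l \<noteq> []" "(f \<star> pbasis u l) p \<noteq> 0"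
  shows "Suc n \<le> length (snd p)"
proof -
  obtain u' l' where p: "p = (u', l')" by fastforce
  obtain l1 where "l' = l1 @ l" "f (u', l1) \<noteq> 0"
    using assms(3) unfolding p by (auto simp: pbasis_def split: if_splits elim!: pmul_nonzeroE)
  with assms(1)[of "(u', l1)"] assms(2) show ?thesis
    by (cases l) (auto simp: p)
qed

end

section \<open>Free modules and their images\<close>

text \<open>The module axioms without unitality; the regular module is one without further work.\<close>
locale premodule =
  fixes A :: "'r ralg" and M :: "('m, 'r) rmod"
  assumes zero_closed [simp]: "mzero M \<in> mcar M"
    and add_closed [simp]: "x \<in> mcar M \<Longrightarrow> y \<in> mcar M \<Longrightarrow> madd M x y \<in> mcar M"
    and act_closed [simp]: "x \<in> mcar M \<Longrightarrow> r \<in> rcar A \<Longrightarrow> mact M x r \<in> mcar M"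
    and add_assoc: "x \<in> mcar M \<Longrightarrow> y \<in> mcar M \<Longrightarrow> z \<in> mcar M \<Longrightarrow>
      madd M (madd M x y) z = madd M x (madd M y z)"
    and add_comm: "x \<in> mcar M \<Longrightarrow> y \<in> mcar M \<Longrightarrow> madd M x y = madd M y x"
    and add_zero [simp]: "x \<in> mcar M \<Longrightarrow> madd M (mzero M) x = x"
    and add_inverse: "x \<in> mcar M \<Longrightarrow> \<exists>y\<in>mcar M. madd M x y = mzero M"
    and act_radd: "x \<in> mcar M \<Longrightarrow> r \<in> rcar A \<Longrightarrow> s \<in> rcar A \<Longrightarrow>
      mact M x (radd A r s) = madd M (mact M x r) (mact M x s)"
    and act_madd: "x \<in> mcar M \<Longrightarrow> y \<in> mcar M \<Longrightarrow> r \<in> rcar A \<Longrightarrow>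
      mact M (madd M x y) r = madd M (mact M x r) (mact M y r)"
    and act_rmul: "x \<in> mcar M \<Longrightarrow> r \<in> rcar A \<Longrightarrow> s \<in> rcar A \<Longrightarrow>
      mact M (mact M x r) s = mact M x (rmul A r s)"
begin

lemma add_zero_right [simp]: "x \<in> mcar M \<Longrightarrow> madd M x (mzero M) = x"
  using add_comm[of x "mzero M"] by simp

text \<open>Cancellation by an additive inverse. Additive maps are not assumed to preserve zero, and
  this is how they are seen to do so.\<close>

lemma add_idem_zero:
  assumes "x \<in> mcar M" "madd M x x = x"
  shows "x = mzero M"
proof -
  obtain y where y: "y \<in> mcar M" "madd M x y = mzero M" using add_inverse assms(1) by blast
  have "x = madd M x (madd M x y)" using assms y by simp
  also have "\<dots> = madd M (madd M x x) y" using assms(1) y(1) by (simp add: add_assoc)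
  finally show ?thesis using assms y by simp
qed

lemma act_zero_left: "r \<in> rcar A \<Longrightarrow> mact M (mzero M) r = mzero M"
  using act_madd[of "mzero M" "mzero M" r] by (simp add: add_idem_zero)

lemma msum_closed: "set xs \<subseteq> mcar M \<times> rcar A \<Longrightarrow> msum M xs \<in> mcar M"
  by (induction xs) (auto simp: msum_def)

lemma msum_append:
  "set xs \<subseteq> mcar M \<times> rcar A \<Longrightarrow> set ys \<subseteq> mcar M \<times> rcar A \<Longrightarrow>
    msum M (xs @ ys) = madd M (msum M xs) (msum M ys)"
proof (induction xs)
  case Nil
  then show ?case using msum_closed by (simp add: msum_def)
next
  case (Cons p xs)
  then show ?case using msum_closed[of xs] msum_closed[of ys]
    by (cases p) (auto simp: msum_def add_assoc)
qed

end

text \<open>The extra condition says \<open>M = M A\<close>; for an algebra without identity it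
  takes the place of the identity acting trivially.\<close>

lemma rmodule_iff_premodule:
  "rmodule A M \<longleftrightarrow> premodule A M \<and>
     (\<forall>x\<in>mcar M. \<exists>xs. set xs \<subseteq> mcar M \<times> rcar A \<and> x = msum M xs)"
  by (simp only: rmodule_def premodule_def Ball_def all_simps conj_assoc)

lemma mhom_zero:
  assumes "premodule A M" "premodule A N" "mhom A M N f"
  shows "f (mzero M) = mzero N"
proof -
  interpret M: premodule A M by fact
  interpret N: premodule A N by fact
  have "madd N (f (mzero M)) (f (mzero M)) = f (mzero M)"
    using assms(3) unfolding mhom_def by (metis M.add_zero M.zero_closed)
  then show ?thesis using assms(3) by (simp add: N.add_idem_zero mhom_def)
qed

section \<open>Direct sums of vertex ideals and their universal property\<close>

context quiver
begin

lemma premodule_regular: "premodule PA (regular_module (PA :: ('v \<times> 'e list \<Rightarrow> 'k::field) ralg))"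
proof unfold_locales
  fix x :: "'v \<times> 'e list \<Rightarrow> 'k"
  assume "x \<in> mcar (regular_module PA)"
  then show "\<exists>y\<in>mcar (regular_module PA). madd (regular_module PA) x y = mzero (regular_module PA)"
    by (intro bexI[of _ "- x"]) (auto simp: carrier_minus)
qed (auto simp: carrier_add pmul_closed pmul_assoc pmul_add_left pmul_add_right add_ac)

lemma premodule_act_zero:
  fixes M :: "('m, 'v \<times> 'e list \<Rightarrow> 'k::field) rmod"
  assumes "premodule PA M" "x \<in> mcar M"
  shows "mact M x 0 = mzero M"
proof -
  interpret premodule PA M by fact
  show ?thesis using act_radd[of x 0 0] assms(2) by (simp add: add_idem_zero)
qed

text \<open>The direct sum of the ideals at the vertices \<open>u i\<close> for \<open>i\<close> in
  \<open>I\<close>. Elements vanish off \<open>I\<close>, so sums over different index sets share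
  one type.\<close>

definition free_on :: "('i \<Rightarrow> 'v) \<Rightarrow> 'i set \<Rightarrow> ('i \<Rightarrow> 'v \<times> 'e list \<Rightarrow> 'k::field) set" where
  "free_on u I = {x. finite {i. x i \<noteq> 0} \<and> (\<forall>i. x i \<in> ideal_at (u i)) \<and> (\<forall>i. x i \<noteq> 0 \<longrightarrow> i \<in> I)}"

definition free_act :: "('i \<Rightarrow> 'v \<times> 'e list \<Rightarrow> 'k::field) \<Rightarrow> ('v \<times> 'e list \<Rightarrow> 'k) \<Rightarrow> ('i \<Rightarrow> 'v \<times> 'e list \<Rightarrow> 'k)" where
  "free_act x r = (\<lambda>i. x i \<star> r)"

definition single :: "'i \<Rightarrow> ('v \<times> 'e list \<Rightarrow> 'k::field) \<Rightarrow> ('i \<Rightarrow> 'v \<times> 'e list \<Rightarrow> 'k)" where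
  "single i a = (\<lambda>j. if j = i then a else 0)"

lemma free_on_zero [simp]: "0 \<in> free_on u I"
  by (simp add: free_on_def)

lemma free_on_add [simp]: "x \<in> free_on u I \<Longrightarrow> y \<in> free_on u I \<Longrightarrow> x + y \<in> free_on u I"
  unfolding free_on_def
  by (auto simp: ideal_at_add intro: finite_subset[of _ "{i. x i \<noteq> 0} \<union> {i. y i \<noteq> 0}"])
    (metis add.right_neutral)

lemma free_on_minus [simp]: "x \<in> free_on u I \<Longrightarrow> - x \<in> free_on u I"
  by (auto simp: free_on_def ideal_at_minus)

lemma free_on_diff [simp]: "x \<in> free_on u I \<Longrightarrow> y \<in> free_on u I \<Longrightarrow> x - y \<in> free_on u I"
  using free_on_add[of x u I "- y"] by simp

lemma free_on_act [simp]: "x \<in> free_on u I \<Longrightarrow> r \<in> rcar PA \<Longrightarrow> free_act x r \<in> free_on u I"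
  unfolding free_on_def free_act_def
  by (auto simp: ideal_at_mult intro: finite_subset[of _ "{i. x i \<noteq> 0}"])
    (metis pmul_zero_left)

lemma free_on_single [simp]: "i \<in> I \<Longrightarrow> a \<in> ideal_at (u i) \<Longrightarrow> single i a \<in> free_on u I"
  unfolding free_on_def single_def
  by (auto intro: finite_subset[of _ "{i}"])

lemma free_on_apply: "x \<in> free_on u I \<Longrightarrow> x i \<in> ideal_at (u i)"
  by (simp add: free_on_def)

lemma free_on_apply_carrier: "x \<in> free_on u I \<Longrightarrow> x i \<in> rcar PA"
  using ideal_at_carrier by (auto simp: free_on_def)

lemma free_on_support: "x \<in> free_on u I \<Longrightarrow> x i \<noteq> 0 \<Longrightarrow> i \<in> I"
  by (simp add: free_on_def)

lemma free_act_add: "free_act (x + y) r = free_act x r + free_act y r"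
  by (rule ext) (simp add: free_act_def pmul_add_left)

lemma free_act_diff: "free_act (x - y) r = free_act x r - free_act y r"
  by (rule ext) (simp add: free_act_def pmul_diff_left)

lemma free_act_radd: "free_act x (r + s) = free_act x r + free_act x s"
  by (rule ext) (simp add: free_act_def pmul_add_right)

lemma free_act_rmul: "free_act (free_act x r) s = free_act x (r \<star> s)"
  by (rule ext) (simp add: free_act_def pmul_assoc)

lemma free_act_single: "free_act (single i a) r = single i (a \<star> r)"
  by (rule ext) (simp add: free_act_def single_def)

lemma single_generator: "a \<in> ideal_at (u i) \<Longrightarrow> free_act (single i (pbasis (u i) [])) a = single i a"
  by (simp add: free_act_single pbasis_Nil_mult)

lemma pbasis_Nil_ideal_at [simp]: "pbasis u [] \<in> ideal_at u"
  by (simp add: pbasis_ideal_at)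

text \<open>Induction on a finite set containing the support: subtracting the component at one index
  removes that index.\<close>

lemma free_on_induct [consumes 1, case_names zero single add]:
  assumes "x \<in> free_on u I" "P 0"
    and single: "\<And>i a. i \<in> I \<Longrightarrow> a \<in> ideal_at (u i) \<Longrightarrow> P (single i a)"
    and add: "\<And>x y. x \<in> free_on u I \<Longrightarrow> y \<in> free_on u I \<Longrightarrow> P x \<Longrightarrow> P y \<Longrightarrow> P (x + y)"
  shows "P x"
proof -
  have "P x" if "finite S" "{i. x i \<noteq> 0} \<subseteq> S" "x \<in> free_on u I" for S x
    using that
  proof (induction S arbitrary: x rule: finite_induct)
    case empty
    then have "x = 0" by (intro ext) auto
    show ?case unfolding \<open>x = 0\<close> by (rule assms(2))
  next
    case (insert i S)
    show ?case
    proof (cases "x i = 0")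
      case True
      then have "{j. x j \<noteq> 0} \<subseteq> S" using insert.prems(1) by blast
      then show ?thesis using insert.IH insert.prems(2) by blast
    next
      case False
      then have i: "i \<in> I" using insert.prems by (auto simp: free_on_def)
      have s: "single i (x i) \<in> free_on u I" using i insert.prems by (simp add: free_on_apply)
      define y where "y = x - single i (x i)"
      have y: "y \<in> free_on u I" using s insert.prems by (simp add: y_def)
      have "j \<in> S" if "y j \<noteq> 0" for j
      proof -
        have "y j = (if j = i then 0 else x j)" by (simp add: y_def single_def)
        with that have "j \<noteq> i" "x j \<noteq> 0" by (cases "j = i"; simp)+
        with insert.prems(1) show ?thesis by blast
      qed
      then have "{j. y j \<noteq> 0} \<subseteq> S" by blast
      then have "P y" using insert.IH y by blast
      then have "P (y + single i (x i))"
        by (intro add y s single i free_on_apply[OF insert.prems(2)])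
      moreover have "y + single i (x i) = x" by (simp add: y_def)
      ultimately show ?thesis by simp
    qed
  qed
  from this[OF _ subset_refl assms(1)] show ?thesis using assms(1) by (simp add: free_on_def)
qed

text \<open>Homomorphisms out of \<open>free_on u I\<close> itself, kept apart from any particular
  copy of it as a module record.\<close>

definition free_hom :: "('i \<Rightarrow> 'v) \<Rightarrow> 'i set \<Rightarrow> ('n, 'v \<times> 'e list \<Rightarrow> 'k::field) rmod \<Rightarrow>
    (('i \<Rightarrow> 'v \<times> 'e list \<Rightarrow> 'k) \<Rightarrow> 'n) \<Rightarrow> bool" where
  "free_hom u I N g \<longleftrightarrow>
     (\<forall>x\<in>free_on u I. g x \<in> mcar N) \<and>
     (\<forall>x\<in>free_on u I. \<forall>y\<in>free_on u I. g (x + y) = madd N (g x) (g y)) \<and>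
     (\<forall>x\<in>free_on u I. \<forall>r\<in>rcar PA. g (free_act x r) = mact N (g x) r)"

lemma free_hom_closed: "free_hom u I N g \<Longrightarrow> x \<in> free_on u I \<Longrightarrow> g x \<in> mcar N"
  and free_hom_add: "free_hom u I N g \<Longrightarrow> x \<in> free_on u I \<Longrightarrow> y \<in> free_on u I \<Longrightarrow>
    g (x + y) = madd N (g x) (g y)"
  and free_hom_act: "free_hom u I N g \<Longrightarrow> x \<in> free_on u I \<Longrightarrow> r \<in> rcar PA \<Longrightarrow>
    g (free_act x r) = mact N (g x) r"
  by (simp_all add: free_hom_def)

lemma free_hom_zero:
  assumes "premodule PA N" "free_hom u I N g"
  shows "g 0 = mzero N"
proof -
  have "g (0 + 0) = madd N (g 0) (g 0)" by (rule free_hom_add[OF assms(2)]) simp_all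
  then show ?thesis
    by (metis add_0 assms free_hom_closed free_on_zero premodule.add_idem_zero)
qed

text \<open>The universal property: \<open>x\<close> is sent to the finite sum of the
  \<open>n i\<close> acted on by \<open>x i\<close>.\<close>

lemma free_lift:
  fixes N :: "('n, 'v \<times> 'e list \<Rightarrow> 'k::field) rmod" and u :: "'i \<Rightarrow> 'v"
  assumes "premodule PA N" and n: "\<And>i. i \<in> I \<Longrightarrow> n i \<in> mcar N"
  shows "\<exists>g. free_hom u I N g \<and>
    (\<forall>i\<in>I. \<forall>a\<in>ideal_at (u i). g (single i a) = mact N (n i) a)"
proof -
  interpret N: premodule PA N by fact
  \<comment> \<open>The additive structure of \<open>N\<close> as a commutative monoid, in which
    \<open>finprod\<close> is the finite sum.\<close>
  define G where "G = \<lparr>carrier = mcar N, mult = madd N, one = mzero N\<rparr>"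
  interpret G: comm_monoid G
    by (rule comm_monoidI) (auto simp: G_def N.add_assoc intro: N.add_comm)
  have G_simps: "carrier G = mcar N" "mult G = madd N" "one G = mzero N"
    by (simp_all add: G_def)
  define T where "T x i = mact N (n i) (x i)" for x :: "'i \<Rightarrow> 'v \<times> 'e list \<Rightarrow> 'k" and i
  define g where "g x = finprod G (T x) {i. x i \<noteq> 0}" for x
  have T: "T x i \<in> mcar N" if "x \<in> free_on u I" "i \<in> I" for x i
    using that by (simp add: T_def n free_on_apply_carrier)
  \<comment> \<open>Summing over a finite set larger than the support allows two elements and their
    sum to be treated over one index set.\<close>
  have g: "g x = finprod G (T x) S" if x: "x \<in> free_on u I" and S: "finite S" "{i. x i \<noteq> 0} \<subseteq> S" "S \<subseteq> I" for x S
    unfolding g_def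
  proof (rule G.finprod_mono_neutral_cong_left)
    show "\<And>i. i \<in> S - {i. x i \<noteq> 0} \<Longrightarrow> T x i = \<one>\<^bsub>G\<^esub>"
    proof -
      fix i assume i: "i \<in> S - {i. x i \<noteq> 0}"
      then have "x i = 0" "i \<in> I" using S by blast+
      then show "T x i = \<one>\<^bsub>G\<^esub>"
        using premodule_act_zero[OF assms(1) n] by (simp add: T_def G_simps)
    qed
    show "T x \<in> S \<rightarrow> carrier G" using S T[OF x] by (auto simp: G_simps)
  qed (use S in auto)
  have supp: "finite {i. x i \<noteq> 0}" "{i. x i \<noteq> 0} \<subseteq> I" if "x \<in> free_on u I" for x :: "'i \<Rightarrow> 'v \<times> 'e list \<Rightarrow> 'k"
    using that by (auto simp: free_on_def)
  show ?thesis
    unfolding free_hom_def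
  proof (intro exI[of _ g] conjI ballI)
    fix x :: "'i \<Rightarrow> 'v \<times> 'e list \<Rightarrow> 'k" assume x: "x \<in> free_on u I"
    show "g x \<in> mcar N" unfolding g_def G_simps[symmetric]
      by (rule G.finprod_closed) (use T[OF x] supp[OF x] in \<open>auto simp: G_simps\<close>)
  next
    fix x y :: "'i \<Rightarrow> 'v \<times> 'e list \<Rightarrow> 'k"
    assume x: "x \<in> free_on u I" and y: "y \<in> free_on u I"
    define S where "S = {i. x i \<noteq> 0} \<union> {i. y i \<noteq> 0}"
    have S: "finite S" "S \<subseteq> I" using supp x y by (auto simp: S_def)
    have "g (x + y) = finprod G (T (x + y)) S"
      by (rule g) (use x y S in \<open>auto simp: S_def\<close>)
    also have "\<dots> = finprod G (\<lambda>i. madd N (T x i) (T y i)) S"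
    proof (rule G.finprod_cong')
      show "(\<lambda>i. madd N (T x i) (T y i)) \<in> S \<rightarrow> carrier G"
        using S T x y by (auto simp: G_simps)
      show "\<And>i. i \<in> S \<Longrightarrow> T (x + y) i = madd N (T x i) (T y i)"
        using S n x y N.act_radd by (auto simp: T_def free_on_apply_carrier)
    qed simp
    also have "\<dots> = madd N (finprod G (T x) S) (finprod G (T y) S)"
      unfolding G_simps[symmetric]
      by (rule G.finprod_multf) (use S T x y in \<open>auto simp: G_simps\<close>)
    also have "\<dots> = madd N (g x) (g y)"
      using g[OF x, of S] g[OF y, of S] S by (auto simp: S_def)
    finally show "g (x + y) = madd N (g x) (g y)" .
  next
    fix x :: "'i \<Rightarrow> 'v \<times> 'e list \<Rightarrow> 'k" and r :: "'v \<times> 'e list \<Rightarrow> 'k"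
    assume x: "x \<in> free_on u I" and r: "r \<in> rcar PA"
    define S where "S = {i. x i \<noteq> 0}"
    have S: "finite S" "S \<subseteq> I" using supp x by (auto simp: S_def)
    have "g (free_act x r) = finprod G (T (free_act x r)) S"
      by (rule g[OF free_on_act[OF x r]]) (use S in \<open>auto simp: S_def free_act_def\<close>)
    also have "\<dots> = finprod G (\<lambda>i. mact N (T x i) r) S"
    proof (rule G.finprod_cong')
      show "(\<lambda>i. mact N (T x i) r) \<in> S \<rightarrow> carrier G"
        using S T x r by (auto simp: G_simps)
      show "\<And>i. i \<in> S \<Longrightarrow> T (free_act x r) i = mact N (T x i) r"
        using S n x r N.act_rmul by (auto simp: T_def free_act_def free_on_apply_carrier)
    qed simp
    also have "\<dots> = mact N (finprod G (T x) S) r"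
      using S
    proof (induction S rule: finite_induct)
      case empty
      then show ?case using r N.act_zero_left by (simp add: G_simps)
    next
      case (insert i S)
      have 1: "(\<lambda>i. mact N (T x i) r) \<in> S \<rightarrow> carrier G" "mact N (T x i) r \<in> carrier G"
        "T x \<in> S \<rightarrow> carrier G" "T x i \<in> carrier G"
        using insert T x r by (auto simp: G_simps)
      then have "finprod G (T x) S \<in> carrier G" by simp
      with 1 show ?case using insert r N.act_madd by (simp add: G_simps)
    qed
    finally show "g (free_act x r) = mact N (g x) r" by (simp add: g_def S_def)
  next
    fix i and a :: "'v \<times> 'e list \<Rightarrow> 'k"
    assume i: "i \<in> I" and a: "a \<in> ideal_at (u i)"
    have "T (single i a) i \<in> carrier G" using T i a by (simp add: G_simps)
    moreover have "g (single i a) = finprod G (T (single i a)) {i}"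
      by (rule g[OF free_on_single[where u = u, OF i a]]) (use i in \<open>auto simp: single_def\<close>)
    ultimately have "g (single i a) = T (single i a) i"
      using N.add_zero_right by (simp add: G_simps)
    then show "g (single i a) = mact N (n i) a" by (simp add: T_def single_def)
  qed
qed

end

text \<open>A module with underlying set \<open>q ` free_on u I\<close>: for injective \<open>q\<close> a copy of the free module
  inside another type, for general \<open>q\<close> a quotient of it.\<close>
locale free_image = quiver src tgt for src tgt :: "'e \<Rightarrow> 'v" +
  fixes u :: "'i \<Rightarrow> 'v" and I :: "'i set" and q :: "('i \<Rightarrow> 'v \<times> 'e list \<Rightarrow> 'k::field) \<Rightarrow> 'm"
  assumes q_add: "\<lbrakk>x \<in> free_on u I; x' \<in> free_on u I; y \<in> free_on u I; q x = q x'\<rbrakk> \<Longrightarrow> q (x + y) = q (x' + y)"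
    and q_act: "\<lbrakk>x \<in> free_on u I; x' \<in> free_on u I; r \<in> rcar PA; q x = q x'\<rbrakk> \<Longrightarrow>
      q (free_act x r) = q (free_act x' r)"
begin

abbreviation rep :: "'m \<Rightarrow> ('i \<Rightarrow> 'v \<times> 'e list \<Rightarrow> 'k)" where
  "rep \<equiv> inv_into (free_on u I) q"

text \<open>Operations are computed on chosen preimages under \<open>q\<close>; the locale
  assumptions make the results independent of the choice.\<close>

definition Mod :: "('m, 'v \<times> 'e list \<Rightarrow> 'k) rmod" where
  "Mod = \<lparr>mcar = q ` free_on u I, madd = \<lambda>a b. q (rep a + rep b), mzero = q 0,
          mact = \<lambda>a r. q (free_act (rep a) r)\<rparr>"

lemma rep_closed: "x \<in> free_on u I \<Longrightarrow> rep (q x) \<in> free_on u I"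
  by (simp add: inv_into_into)

lemma q_rep: "x \<in> free_on u I \<Longrightarrow> q (rep (q x)) = q x"
  by (simp add: f_inv_into_f)

lemma mcar_Mod [simp]: "mcar Mod = q ` free_on u I"
  by (simp add: Mod_def)

lemma mzero_Mod [simp]: "mzero Mod = q 0"
  by (simp add: Mod_def)

text \<open>Since \<open>q_add\<close> changes only the left summand, it is applied once on each
  side of a commutation.\<close>

lemma madd_Mod [simp]:
  assumes "x \<in> free_on u I" "y \<in> free_on u I"
  shows "madd Mod (q x) (q y) = q (x + y)"
proof -
  have "q (rep (q x) + rep (q y)) = q (x + rep (q y))"
    using assms by (intro q_add) (auto simp: rep_closed q_rep)
  also have "\<dots> = q (rep (q y) + x)" by (simp add: add.commute)
  also have "\<dots> = q (y + x)"
    using assms by (intro q_add) (auto simp: rep_closed q_rep)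
  finally show ?thesis by (simp add: Mod_def add.commute)
qed

lemma mact_Mod [simp]:
  assumes "x \<in> free_on u I" "r \<in> rcar PA"
  shows "mact Mod (q x) r = q (free_act x r)"
  unfolding Mod_def using assms by (auto intro!: q_act simp: rep_closed q_rep)

lemma premodule_Mod: "premodule PA Mod"
proof unfold_locales
  show "mzero Mod \<in> mcar Mod"
    unfolding mzero_Mod mcar_Mod by (rule imageI) (rule free_on_zero)
next
  fix a assume "a \<in> mcar Mod"
  then obtain x where x: "x \<in> free_on u I" "a = q x" by auto
  have "madd Mod (q x) (q (- x)) = mzero Mod"
    using madd_Mod[OF x(1) free_on_minus[OF x(1)]] unfolding add.right_inverse mzero_Mod .
  then show "\<exists>b\<in>mcar Mod. madd Mod a b = mzero Mod"
    unfolding x(2) mcar_Mod using free_on_minus[OF x(1)] by blast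
qed (auto simp: add_ac free_act_add free_act_radd free_act_rmul pmul_closed carrier_add)

lemma rmodule_Mod: "rmodule PA Mod"
  unfolding rmodule_iff_premodule
proof (intro conjI premodule_Mod ballI)
  interpret P: premodule PA Mod by (rule premodule_Mod)
  fix a assume "a \<in> mcar Mod"
  then obtain x where x: "x \<in> free_on u I" "a = q x" by auto
  from x(1) have "\<exists>xs. set xs \<subseteq> mcar Mod \<times> rcar PA \<and> q x = msum Mod xs"
  proof (induction rule: free_on_induct)
    case zero
    \<comment> \<open>The goal contains an eta-expanded \<open>0\<close>, which the simplifier would take apart.\<close>
    have "q 0 = msum Mod []" by (simp add: msum_def)
    then show ?case by (intro exI[of _ "[]"] conjI) (simp, assumption)
  next
    case (single i a)
    then show ?case
      by (intro exI[of _ "[(q (single i (pbasis (u i) [])), a)]"])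
        (auto simp: msum_def ideal_at_carrier single_generator)
  next
    case (add x y)
    then obtain xs ys where "set xs \<subseteq> mcar Mod \<times> rcar PA" "q x = msum Mod xs"
      "set ys \<subseteq> mcar Mod \<times> rcar PA" "q y = msum Mod ys" by auto
    then have "set (xs @ ys) \<subseteq> mcar Mod \<times> rcar PA \<and> q (x + y) = msum Mod (xs @ ys)"
      using add madd_Mod[of x y] P.msum_append[of xs ys] by (simp del: mcar_Mod madd_Mod)
    then show ?case by blast
  qed
  then show "\<exists>xs. set xs \<subseteq> mcar Mod \<times> rcar PA \<and> a = msum Mod xs" using x by simp
qed

lemma mhom_Mod_iff: "mhom PA Mod N h \<longleftrightarrow> free_hom u I N (\<lambda>x. h (q x))"
  by (simp add: mhom_def free_hom_def)

lemma free_hom_q: "free_hom u I Mod q"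
  by (simp add: free_hom_def)

lemma free_hom_cong: "(\<And>x. x \<in> free_on u I \<Longrightarrow> g x = h x) \<Longrightarrow> free_hom u I N g \<longleftrightarrow> free_hom u I N h"
  unfolding free_hom_def by (simp add: pmul_closed)

text \<open>Preimages of the generators under \<open>f\<close> extend to a homomorphism by
  \<open>free_lift\<close>. It is a section on single components, hence everywhere by
  induction.\<close>

lemma projective_Mod:
  assumes inj: "inj_on q (free_on u I)"
  shows "projective PA Mod"
  unfolding projective_def
proof (intro conjI rmodule_Mod allI impI)
  fix N :: "('m \<Rightarrow> 'v \<times> 'e list \<Rightarrow> 'k, 'v \<times> 'e list \<Rightarrow> 'k) rmod" and f
  assume "rmodule PA N \<and> mhom PA N Mod f \<and> f ` mcar N = mcar Mod"
  then have N: "premodule PA N" and f: "mhom PA N Mod f" and surj: "f ` mcar N = mcar Mod"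
    by (auto simp: rmodule_iff_premodule)
  have "\<exists>y. i \<in> I \<longrightarrow> y \<in> mcar N \<and> f y = q (single i (pbasis (u i) []))" for i
  proof (cases "i \<in> I")
    case True
    then have "q (single i (pbasis (u i) [])) \<in> f ` mcar N" using surj by auto
    then show ?thesis by force
  qed simp
  then obtain n where n: "\<And>i. i \<in> I \<Longrightarrow> n i \<in> mcar N"
    "\<And>i. i \<in> I \<Longrightarrow> f (n i) = q (single i (pbasis (u i) []))"
    by metis
  obtain g where g: "free_hom u I N g"
    and gs: "\<And>i a. i \<in> I \<Longrightarrow> a \<in> ideal_at (u i) \<Longrightarrow> g (single i a) = mact N (n i) a"
    using free_lift[where u = u and n = n and I = I, OF N n(1)] by metis
  have fg: "f (g x) = q x" if "x \<in> free_on u I" for x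
    using that
  proof (induction rule: free_on_induct)
    case zero
    have "f (g 0) = q 0" using mhom_zero[OF N premodule_Mod f] free_hom_zero[OF N g] by simp
    then show ?case .
  next
    case (single i a)
    have "f (mact N (n i) a) = mact Mod (f (n i)) a"
      using f single n by (simp add: mhom_def ideal_at_carrier)
    then show ?case using single n gs by (simp add: ideal_at_carrier single_generator)
  next
    case (add x y)
    have "f (madd N (g x) (g y)) = madd Mod (f (g x)) (f (g y))"
      using f add free_hom_closed[OF g] by (simp add: mhom_def)
    then have "f (g (x + y)) = q (x + y)" using add free_hom_add[OF g] by simp
    then show ?case .
  qed
  have r: "rep (q x) = x" if "x \<in> free_on u I" for x
    using inj that by (rule inv_into_f_f)
  have "free_hom u I N (\<lambda>x. g (rep (q x)))"
    using g free_hom_cong[of "\<lambda>x. g (rep (q x))" g] r by simp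
  then show "\<exists>g. mhom PA Mod N g \<and> (\<forall>x\<in>mcar Mod. f (g x) = x)"
    using fg r by (intro exI[of _ "\<lambda>a. g (rep a)"]) (auto simp: mhom_Mod_iff)
qed

end

section \<open>Limit ordinals and ladder systems\<close>

unbundle cardinal_syntax

section \<open>The order of the first uncountable ordinal\<close>

lemma omega1_Card_order: "Card_order omega1"
  by (simp add: cardSuc_Card_order natLeq_Card_order)

lemma omega1_Well_order: "Well_order omega1"
  using omega1_Card_order by (simp add: card_order_on_well_order_on)

lemma olt_Field: "olt a b \<Longrightarrow> a \<in> Field omega1 \<and> b \<in> Field omega1"
  by (auto simp: olt_def intro: FieldI1 FieldI2)

lemma olt_irrefl [simp]: "\<not> olt a a"
  by (simp add: olt_def)

lemma olt_trans: "olt a b \<Longrightarrow> olt b c \<Longrightarrow> olt a c"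
  using omega1_Well_order
  unfolding olt_def well_order_on_def linear_order_on_def partial_order_on_def preorder_on_def
  by (metis antisymD transE)

lemma olt_total: "a \<in> Field omega1 \<Longrightarrow> b \<in> Field omega1 \<Longrightarrow> olt a b \<or> a = b \<or> olt b a"
  using omega1_Well_order
  unfolding olt_def well_order_on_def linear_order_on_def total_on_def by blast

lemma olt_minimal:
  assumes "B \<noteq> {}"
  obtains b where "b \<in> B" "\<And>c. olt c b \<Longrightarrow> c \<notin> B"
proof -
  have "wf (omega1 - Id)" using omega1_Well_order by (simp add: well_order_on_def)
  with assms obtain b where "b \<in> B" "\<And>c. (c, b) \<in> omega1 - Id \<Longrightarrow> c \<notin> B"
    by (metis wfE_min ex_in_conv)
  then show thesis using that by (auto simp: olt_def)
qed

section \<open>Countable initial segments, closing off and ladders\<close>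

lemma countable_iff_ordLeq_natLeq: "countable A \<longleftrightarrow> |A| \<le>o natLeq"
proof -
  have "countable A \<longleftrightarrow> |A| \<le>o |UNIV :: nat set|"
    unfolding card_of_ordLeq[symmetric] countable_def by auto
  then show ?thesis
    using card_of_nat ordIso_symmetric ordLeq_ordIso_trans by blast
qed

text \<open>Proper initial segments of a cardinal are smaller than it, and below the successor of
  aleph-zero this means countable.\<close>

lemma countable_below: "countable {b. olt b a}"
proof (cases "a \<in> Field omega1")
  case True
  have "|underS omega1 a| <o omega1"
    by (rule card_of_underS[OF omega1_Card_order True])
  then have "|underS omega1 a| \<le>o natLeq"
    by (simp add: cardSuc_ordLeq_ordLess natLeq_Card_order card_of_Card_order)
  then have "countable (underS omega1 a)" by (simp add: countable_iff_ordLeq_natLeq)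
  moreover have "{b. olt b a} = underS omega1 a" by (auto simp: olt_def underS_def)
  ultimately show ?thesis by simp
next
  case False
  then have "{b. olt b a} = {}" using olt_Field by blast
  then show ?thesis by simp
qed

lemma uncountable_Field: "uncountable (Field omega1)"
proof
  assume "countable (Field omega1)"
  then have "omega1 \<le>o natLeq"
    unfolding countable_iff_ordLeq_natLeq
    using card_of_Field_ordIso[OF omega1_Card_order] ordIso_symmetric ordIso_ordLeq_trans by blast
  then show False
    using cardSuc_greater[OF natLeq_Card_order] not_ordLess_ordLeq by blast
qed

text \<open>Otherwise the whole field would be a countable union of countable initial
  segments.\<close>

lemma countable_bounded:
  assumes "countable C" "C \<subseteq> Field omega1"
  shows "\<exists>b. \<forall>c\<in>C. olt c b"
proof (rule ccontr)
  assume n: "\<nexists>b. \<forall>c\<in>C. olt c b"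
  have "Field omega1 \<subseteq> C \<union> (\<Union>c\<in>C. {b. olt b c})"
  proof
    fix b assume b: "b \<in> Field omega1"
    obtain c where "c \<in> C" "\<not> olt c b" using n by blast
    then show "b \<in> C \<union> (\<Union>c\<in>C. {b. olt b c})"
      using olt_total[OF b, of c] assms(2) by blast
  qed
  moreover have "countable (C \<union> (\<Union>c\<in>C. {b. olt b c}))"
    using assms(1) countable_below by auto
  ultimately show False using countable_subset uncountable_Field by blast
qed

text \<open>A closing-off argument: \<open>\<delta>\<close> is the least upper bound of a sequence
  whose next term always exceeds every value of \<open>H\<close> at points up to the current
  term.\<close>

lemma exists_closed_limit:
  assumes H: "\<And>b. b \<in> Field omega1 \<Longrightarrow> countable (H b)" "\<And>b. b \<in> Field omega1 \<Longrightarrow> H b \<subseteq> Field omega1"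
  obtains \<delta> where "is_limit \<delta>" "\<And>b c. olt b \<delta> \<Longrightarrow> c \<in> H b \<Longrightarrow> olt c \<delta>"
proof -
  define D where "D a = {b. olt b a} \<union> {a}" for a
  have D: "countable (D a)" for a using countable_below by (simp add: D_def)
  have "\<exists>a'. a \<in> Field omega1 \<longrightarrow> olt a a' \<and> (\<forall>b\<in>D a. \<forall>c\<in>H b. olt c a')" for a
  proof (cases "a \<in> Field omega1")
    case True
    have DF: "D a \<subseteq> Field omega1" using True olt_Field by (auto simp: D_def)
    have "\<exists>b. \<forall>c\<in>insert a (\<Union>b\<in>D a. H b). olt c b"
    proof (rule countable_bounded)
      show "countable (insert a (\<Union>b\<in>D a. H b))" using DF D H by (auto intro!: countable_UN)
      show "insert a (\<Union>b\<in>D a. H b) \<subseteq> Field omega1" using True DF H by blast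
    qed
    then show ?thesis by blast
  qed simp
  then obtain S where S: "\<And>a. a \<in> Field omega1 \<Longrightarrow> olt a (S a)"
    "\<And>a b c. a \<in> Field omega1 \<Longrightarrow> b \<in> D a \<Longrightarrow> c \<in> H b \<Longrightarrow> olt c (S a)"
    by metis
  obtain a0 where a0: "a0 \<in> Field omega1"
    using uncountable_Field by (metis countable_empty ex_in_conv)
  define a where "a n = (S ^^ n) a0" for n
  have aF: "a n \<in> Field omega1" for n
    by (induction n) (use a0 S(1) olt_Field in \<open>auto simp: a_def\<close>)
  have aS: "a (Suc n) = S (a n)" for n by (simp add: a_def)
  have "range a \<subseteq> Field omega1" using aF by blast
  then have "\<exists>b. \<forall>c\<in>range a. olt c b" by (intro countable_bounded) simp_all
  then have "{b. \<forall>n. olt (a n) b} \<noteq> {}" by blast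
  then obtain \<delta> where d: "\<And>n. olt (a n) \<delta>" and m: "\<And>c. olt c \<delta> \<Longrightarrow> \<not> (\<forall>n. olt (a n) c)"
    using olt_minimal[of "{b. \<forall>n. olt (a n) b}"] by auto
  \<comment> \<open>By minimality of \<open>\<delta>\<close>, anything smaller is already at or
    below some term of the sequence.\<close>
  have below: "\<exists>n. b \<in> D (a n)" if b: "olt b \<delta>" for b
  proof -
    obtain n where "\<not> olt (a n) b" using m[OF b] by blast
    then have "b \<in> D (a n)" using olt_total[OF aF[of n], of b] olt_Field[OF b] by (auto simp: D_def)
    then show ?thesis by blast
  qed
  show thesis
  proof (rule that)
    show "olt c \<delta>" if "olt b \<delta>" "c \<in> H b" for b c
      using below[OF that(1)] S(2)[OF aF _ that(2)] d olt_trans aS by metis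
    show "is_limit \<delta>"
      unfolding is_limit_def
    proof (intro conjI allI impI)
      show "\<delta> \<in> Field omega1" "\<exists>b. olt b \<delta>" using d olt_Field by blast+
      fix b assume b: "olt b \<delta>"
      then obtain n where "b \<in> D (a n)" using below by blast
      then have "olt b (a (Suc n))" using S(1)[OF aF[of n]] olt_trans by (auto simp: D_def aS)
      then show "\<exists>c. olt b c \<and> olt c \<delta>" using d by blast
    qed
  qed
qed

text \<open>The points below \<open>\<alpha>\<close> form a countable set; the ladder climbs past
  its enumerated points one by one.\<close>

lemma exists_ladder:
  assumes "is_limit \<alpha>"
  shows "\<exists>z. (\<forall>n. olt (z n) \<alpha>) \<and> (\<forall>n. olt (z n) (z (Suc n))) \<and> (\<forall>\<beta>. olt \<beta> \<alpha> \<longrightarrow> (\<exists>n. olt \<beta> (z n)))"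
proof -
  have ne: "{b. olt b \<alpha>} \<noteq> {}" and step: "\<And>b. olt b \<alpha> \<Longrightarrow> \<exists>c. olt b c \<and> olt c \<alpha>"
    using assms by (auto simp: is_limit_def)
  define e where "e = from_nat_into {b. olt b \<alpha>}"
  have e: "range e = {b. olt b \<alpha>}"
    unfolding e_def by (rule range_from_nat_into[OF ne countable_below])
  have max: "\<exists>c. olt a c \<and> olt b c \<and> olt c \<alpha>" if "olt a \<alpha>" "olt b \<alpha>" for a b
    using olt_total[of a b] olt_Field that step olt_trans by metis
  \<comment> \<open>Being above \<open>e n\<close> makes the sequence cofinal; the second condition
    makes it increasing.\<close>
  have "\<exists>z. \<forall>n. (olt (e n) (z n) \<and> olt (z n) \<alpha>) \<and> olt (z n) (z (Suc n))"
  proof (rule dependent_nat_choice)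
    show "\<exists>x. olt (e 0) x \<and> olt x \<alpha>" using e step by blast
    show "\<exists>y. (olt (e (Suc n)) y \<and> olt y \<alpha>) \<and> olt x y" if "olt (e n) x \<and> olt x \<alpha>" for x n
      using max[of x "e (Suc n)"] that e by blast
  qed
  then obtain z where z: "\<And>n. olt (e n) (z n)" "\<And>n. olt (z n) \<alpha>" "\<And>n. olt (z n) (z (Suc n))"
    by blast
  show ?thesis
  proof (intro exI[of _ z] conjI allI impI z)
    fix b assume "olt b \<alpha>"
    then obtain n where "b = e n" using e by blast
    then show "\<exists>n. olt b (z n)" using z(1) by blast
  qed
qed

lemma exists_ladder_system: "\<exists>\<zeta>. ladder_system \<zeta>"
  unfolding ladder_system_def using exists_ladder by metis

lemma ladder_system_inj:
  assumes "ladder_system \<zeta>" "is_limit \<alpha>" "\<zeta> \<alpha> m = \<zeta> \<alpha> n"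
  shows "m = n"
proof -
  have "olt (\<zeta> \<alpha> m) (\<zeta> \<alpha> (m + Suc k))" for m k
    by (induction k) (use assms olt_trans in \<open>auto simp: ladder_system_def\<close>)
  then have "m < n \<Longrightarrow> olt (\<zeta> \<alpha> m) (\<zeta> \<alpha> n)" for m n
    by (metis add_Suc_right less_iff_Suc_add)
  then show ?thesis using assms(3) by (metis linorder_neqE_nat olt_irrefl)
qed

section \<open>The presentation\<close>

text \<open>\<open>(False, \<beta>, n)\<close> stands for the generator \<open>x \<beta> n\<close>; \<open>(True, \<alpha>, n)\<close> stands for \<open>y \<alpha> n\<close> and, for
  limit \<open>\<alpha>\<close>, also for the relation that starts with it.\<close>
type_synonym idx = "bool \<times> nat set \<times> nat"

text \<open>A common form of the two quiver types. The vertices may repeat and each arrow of the ray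
  is replaced by a nonempty path, so a cycle fits as well.\<close>

locale ray_quiver = quiver src tgt for src tgt :: "'e \<Rightarrow> 'v" +
  fixes w :: "nat \<Rightarrow> 'v" and es :: "nat \<Rightarrow> 'e list"
  assumes es_nonempty: "es n \<noteq> []"
    and es_walk: "qwalk src tgt (w (Suc n)) (es n)"
    and es_end: "qend tgt (w (Suc n)) (es n) = w n"
begin

section \<open>Generators, relators and the boundary map\<close>

definition step :: "nat \<Rightarrow> 'v \<times> 'e list \<Rightarrow> 'k::field" where
  "step n = pbasis (w (Suc n)) (es n)"

definition vert :: "idx \<Rightarrow> 'v" where
  "vert i = w (snd (snd i))"

lemma vert_simp [simp]: "vert (b, \<beta>, n) = w n"
  by (simp add: vert_def)

text \<open>The \<open>y \<alpha> n\<close> with \<open>\<alpha>\<close> not a limit are included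
  too; they occur in no relator and only add a free summand.\<close>

definition I0 :: "idx set" where
  "I0 = {i. fst (snd i) \<in> Field omega1}"

definition I1 :: "idx set" where
  "I1 = {i. fst i \<and> is_limit (fst (snd i))}"

lemma I0_iff [simp]: "(b, \<beta>, n) \<in> I0 \<longleftrightarrow> \<beta> \<in> Field omega1"
  by (simp add: I0_def)

lemma I1_iff [simp]: "(b, \<beta>, n) \<in> I1 \<longleftrightarrow> b \<and> is_limit \<beta>"
  by (simp add: I1_def)

abbreviation F0 :: "(idx \<Rightarrow> 'v \<times> 'e list \<Rightarrow> 'k::field) set" where
  "F0 \<equiv> free_on vert I0"

abbreviation F1 :: "(idx \<Rightarrow> 'v \<times> 'e list \<Rightarrow> 'k::field) set" where
  "F1 \<equiv> free_on vert I1"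

lemma step_ideal_at: "step n \<in> ideal_at (w (Suc n))"
  by (simp add: step_def pbasis_ideal_at es_walk)

lemma step_carrier [simp]: "step n \<in> rcar PA"
  by (rule ideal_at_carrier[OF step_ideal_at])

lemma step_mult_ideal_at: "a \<in> rcar PA \<Longrightarrow> step n \<star> a \<in> ideal_at (w (Suc n))"
  by (simp add: step_ideal_at ideal_at_mult)

lemma step_mult_nonzero: "a \<in> ideal_at (w n) \<Longrightarrow> a \<noteq> 0 \<Longrightarrow> step n \<star> a \<noteq> 0"
  unfolding step_def by (rule pbasis_mult_nonzero) (simp_all add: es_walk es_end)

lemma limit_Field: "is_limit \<alpha> \<Longrightarrow> \<alpha> \<in> Field omega1"
  by (simp add: is_limit_def)

lemma ladder_Field: "ladder_system \<zeta> \<Longrightarrow> is_limit \<alpha> \<Longrightarrow> \<zeta> \<alpha> n \<in> Field omega1"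
  using olt_Field unfolding ladder_system_def by blast

definition gen :: "idx \<Rightarrow> idx \<Rightarrow> 'v \<times> 'e list \<Rightarrow> 'k::field" where
  "gen i = single i (pbasis (vert i) [])"

definition relator :: "(nat set \<Rightarrow> nat \<Rightarrow> nat set) \<Rightarrow> nat set \<Rightarrow> nat \<Rightarrow> idx \<Rightarrow> 'v \<times> 'e list \<Rightarrow> 'k::field" where
  "relator \<zeta> \<alpha> n = gen (True, \<alpha>, n) - single (True, \<alpha>, Suc n) (step n) - gen (False, \<zeta> \<alpha> n, n)"

lemma gen_F0: "i \<in> I0 \<Longrightarrow> gen i \<in> F0"
  by (simp add: gen_def)

lemma relator_F0:
  assumes "ladder_system \<zeta>" "is_limit \<alpha>"
  shows "relator \<zeta> \<alpha> n \<in> F0"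
  unfolding relator_def
  by (intro free_on_diff gen_F0 free_on_single)
    (use assms limit_Field ladder_Field step_ideal_at in auto)

lemma relator_act:
  assumes "a \<in> ideal_at (w n)"
  shows "free_act (relator \<zeta> \<alpha> n) a =
    single (True, \<alpha>, n) a - single (True, \<alpha>, Suc n) (step n \<star> a) - single (False, \<zeta> \<alpha> n, n) a"
  unfolding relator_def gen_def free_act_diff free_act_single
  using assms by (simp add: pbasis_Nil_mult)

text \<open>The universal property of \<open>F1\<close> sends the generator for each pair
  \<open>\<alpha>\<close>, \<open>n\<close> to the corresponding relator.\<close>

lemma exists_boundary:
  assumes "ladder_system \<zeta>"
  shows "\<exists>d0 :: (idx \<Rightarrow> 'v \<times> 'e list \<Rightarrow> 'k::field) \<Rightarrow> idx \<Rightarrow> 'v \<times> 'e list \<Rightarrow> 'k.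
    (\<forall>x\<in>F1. d0 x \<in> F0) \<and> (\<forall>x\<in>F1. \<forall>y\<in>F1. d0 (x + y) = d0 x + d0 y) \<and>
    (\<forall>x\<in>F1. \<forall>r\<in>rcar PA. d0 (free_act x r) = free_act (d0 x) r) \<and>
    (\<forall>\<alpha> n. \<forall>a\<in>ideal_at (w n). is_limit \<alpha> \<longrightarrow> d0 (single (True, \<alpha>, n) a) = free_act (relator \<zeta> \<alpha> n) a)"
proof -
  \<comment> \<open>With the identity as \<open>q\<close>, the module \<open>F.Mod\<close> is
    \<open>F0\<close> itself.\<close>
  interpret F: free_image src tgt vert I0 "\<lambda>x. x :: idx \<Rightarrow> 'v \<times> 'e list \<Rightarrow> 'k"
    by unfold_locales simp_all
  have m: "mcar F.Mod = F0" by simp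
  have n: "(case i of (b, \<alpha>, n) \<Rightarrow> relator \<zeta> \<alpha> n) \<in> mcar F.Mod" if "i \<in> I1" for i
    using that unfolding m by (cases i) (simp add: relator_F0[OF assms])
  have "\<exists>g. free_hom vert I1 F.Mod g \<and> (\<forall>i\<in>I1. \<forall>a\<in>ideal_at (vert i).
      g (single i a) = mact F.Mod (case i of (b, \<alpha>, n) \<Rightarrow> relator \<zeta> \<alpha> n) a)"
    by (rule free_lift[OF F.premodule_Mod n])
  then obtain g where g: "free_hom vert I1 F.Mod g"
    and gs: "\<forall>i\<in>I1. \<forall>a\<in>ideal_at (vert i). g (single i a) = mact F.Mod (case i of (b, \<alpha>, n) \<Rightarrow> relator \<zeta> \<alpha> n) a"
    by blast
  have gc: "g x \<in> F0" if "x \<in> F1" for x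
    using free_hom_closed[OF g that] unfolding m .
  show ?thesis
  proof (intro exI[of _ g] conjI ballI allI impI gc)
    show "g (x + y) = g x + g y" if "x \<in> F1" "y \<in> F1" for x y
      using free_hom_add[OF g that] F.madd_Mod[OF gc[OF that(1)] gc[OF that(2)]] by (rule trans)
    show "g (free_act x r) = free_act (g x) r" if "x \<in> F1" "r \<in> rcar PA" for x r
      using free_hom_act[OF g that] F.mact_Mod[OF gc[OF that(1)] that(2)] by (rule trans)
    show "g (single (True, \<alpha>, n) a) = free_act (relator \<zeta> \<alpha> n) a"
      if "a \<in> ideal_at (w n)" "is_limit \<alpha>" for \<alpha> n a
    proof -
      have "g (single (True, \<alpha>, n) a) = mact F.Mod (relator \<zeta> \<alpha> n) a"
        using gs[rule_format, of "(True, \<alpha>, n)" a] that by simp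
      then show ?thesis
        using F.mact_Mod[OF relator_F0[OF assms that(2)] ideal_at_carrier[OF that(1)]] by (rule trans)
    qed
  qed
qed

end

locale presentation = ray_quiver src tgt w es
  for src tgt :: "'e \<Rightarrow> 'v" and w es +
  fixes \<zeta> :: "nat set \<Rightarrow> nat \<Rightarrow> nat set"
    and d0 :: "(idx \<Rightarrow> 'v \<times> 'e list \<Rightarrow> 'k::field) \<Rightarrow> idx \<Rightarrow> 'v \<times> 'e list \<Rightarrow> 'k"
  assumes ladder: "ladder_system \<zeta>"
    and d0_F0: "x \<in> F1 \<Longrightarrow> d0 x \<in> F0"
    and d0_add: "x \<in> F1 \<Longrightarrow> y \<in> F1 \<Longrightarrow> d0 (x + y) = d0 x + d0 y"
    and d0_act: "x \<in> F1 \<Longrightarrow> r \<in> rcar PA \<Longrightarrow> d0 (free_act x r) = free_act (d0 x) r"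
    and d0_single: "is_limit \<alpha> \<Longrightarrow> a \<in> ideal_at (w n) \<Longrightarrow>
      d0 (single (True, \<alpha>, n) a) = free_act (relator \<zeta> \<alpha> n) a"
begin

section \<open>Injectivity of the boundary map\<close>

lemma d0_zero: "d0 0 = 0"
proof -
  have "d0 (0 + 0) = d0 0 + d0 0" by (rule d0_add) simp_all
  then show ?thesis by simp
qed

lemma d0_diff:
  assumes "x \<in> F1" "y \<in> F1"
  shows "d0 (x - y) = d0 x - d0 y"
proof -
  have "d0 (x - y + y) = d0 (x - y) + d0 y" by (rule d0_add) (use assms in simp_all)
  moreover have "x - y + y = x" by simp
  ultimately show ?thesis by (metis add_diff_cancel_right')
qed

text \<open>On the coordinates of the \<open>y \<alpha> n\<close> the boundary map is triangular
  with identity diagonal; the \<open>x\<close> part of a relator lies in the \<open>False\<close>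
  coordinates.\<close>

lemma d0_coord:
  assumes "x \<in> F1"
  shows "d0 x (True, \<alpha>, 0) = x (True, \<alpha>, 0) \<and>
    d0 x (True, \<alpha>, Suc n) = x (True, \<alpha>, Suc n) - step n \<star> x (True, \<alpha>, n)"
  using assms
proof (induction x rule: free_on_induct)
  case zero
  have "d0 0 (True, \<alpha>, 0) = 0 (True, \<alpha>, 0) \<and>
      d0 0 (True, \<alpha>, Suc n) = 0 (True, \<alpha>, Suc n) - step n \<star> 0 (True, \<alpha>, n)"
    by (simp add: d0_zero)
  then show ?case .
next
  case (single i a)
  obtain \<beta> m where i: "i = (True, \<beta>, m)" "is_limit \<beta>" using single(1) by (cases i) auto
  have a: "a \<in> ideal_at (w m)" using single(2) i by simp
  have "d0 (single i a) = single (True, \<beta>, m) a - single (True, \<beta>, Suc m) (step m \<star> a)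
      - single (False, \<zeta> \<beta> m, m) a"
    unfolding i(1) d0_single[OF i(2) a] relator_act[OF a] ..
  then show ?case by (simp add: i(1) single_def)
next
  case (add x y)
  have "d0 (x + y) = d0 x + d0 y" by (rule d0_add[OF add(1,2)])
  then have "d0 (x + y) (True, \<alpha>, 0) = (x + y) (True, \<alpha>, 0) \<and>
      d0 (x + y) (True, \<alpha>, Suc n) = (x + y) (True, \<alpha>, Suc n) - step n \<star> (x + y) (True, \<alpha>, n)"
    using add(3,4) by (simp add: pmul_add_right del: minus_apply)
  then show ?case .
qed

text \<open>The triangular form gives vanishing of the coordinates one after another, from
  \<open>n = 0\<close> upwards.\<close>

lemma d0_eq_zero_iff:
  assumes x: "x \<in> F1"
  shows "d0 x = 0 \<longleftrightarrow> x = 0"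
proof
  assume "d0 x = 0"
  then have d: "d0 x i = 0" for i by simp
  have "x (True, \<alpha>, n) = 0" for \<alpha> n
  proof (induction n)
    case 0
    then show ?case using d0_coord[OF x] d by metis
  next
    case (Suc n)
    have "x (True, \<alpha>, Suc n) - step n \<star> x (True, \<alpha>, n) = 0"
      using d0_coord[OF x] d by metis
    then have "x (True, \<alpha>, Suc n) = 0" using Suc.IH by (simp del: zero_fun_apply)
    then show ?case .
  qed
  moreover have "x (False, \<alpha>, n) = 0" for \<alpha> n
    using x unfolding free_on_def by force
  ultimately have "x i = 0" for i by (cases i) (metis (full_types))
  then show "x = 0" by (intro ext) simp
qed (simp add: d0_zero)

section \<open>The submodule of relations, and why the presentation does not split\<close>

definition relations :: "(idx \<Rightarrow> 'v \<times> 'e list \<Rightarrow> 'k) set" where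
  "relations = d0 ` F1"

lemma relations_I: "x \<in> F1 \<Longrightarrow> y = d0 x \<Longrightarrow> y \<in> relations"
  unfolding relations_def by (rule image_eqI)

lemma relations_zero: "0 \<in> relations"
  using d0_zero by (intro relations_I[OF free_on_zero]) (rule sym)

lemma relations_diff:
  assumes "x \<in> relations" "y \<in> relations"
  shows "x - y \<in> relations"
proof -
  obtain a b where "a \<in> F1" "x = d0 a" "b \<in> F1" "y = d0 b" using assms unfolding relations_def by blast
  then show ?thesis using d0_diff[of a b] by (intro relations_I[of "a - b"]) simp_all
qed

lemma relations_add:
  assumes "x \<in> relations" "y \<in> relations"
  shows "x + y \<in> relations"
proof -
  have "x - (0 - y) \<in> relations" using assms by (intro relations_diff relations_zero)
  then show ?thesis by simp
qed

lemma relations_act: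
  assumes "x \<in> relations" "r \<in> rcar PA"
  shows "free_act x r \<in> relations"
proof -
  obtain a where "a \<in> F1" "x = d0 a" using assms unfolding relations_def by blast
  then show ?thesis using d0_act[of a r] assms(2) by (intro relations_I[of "free_act a r"]) simp_all
qed

lemma relations_F0: "x \<in> relations \<Longrightarrow> x \<in> F0"
  unfolding relations_def using d0_F0 by blast

lemma relator_eq: "relator \<zeta> \<alpha> n =
    gen (True, \<alpha>, n) - free_act (gen (True, \<alpha>, Suc n)) (step n) - gen (False, \<zeta> \<alpha> n, n)"
  by (simp add: relator_def gen_def free_act_single step_ideal_at pbasis_Nil_mult)

lemma relator_S:
  assumes "is_limit \<alpha>"
  shows "relator \<zeta> \<alpha> n \<in> relations"
proof -
  \<comment> \<open>The path in \<open>step n\<close> ends at \<open>w n\<close>, so the trivial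
    path there is a right identity for it.\<close>
  have "step n \<star> pbasis (w n) [] = (step n :: _ \<Rightarrow> 'k)"
    using pbasis_mult_unit[OF es_walk] by (simp add: step_def es_end)
  then have "free_act (relator \<zeta> \<alpha> n) (pbasis (w n) [] :: _ \<Rightarrow> 'k) = relator \<zeta> \<alpha> n"
    unfolding relator_act[OF pbasis_Nil_ideal_at] by (simp add: relator_def gen_def)
  then have "relator \<zeta> \<alpha> n = d0 (single (True, \<alpha>, n) (pbasis (w n) []))"
    using d0_single[OF assms pbasis_Nil_ideal_at] by simp
  then show ?thesis using assms by (intro relations_I[of "single (True, \<alpha>, n) (pbasis (w n) [])"]) simp_all
qed

text \<open>A section of the presentation, composed with the quotient map, would be such an
  endomorphism \<open>G\<close> of \<open>F0\<close>: it kills the relations and is the identity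
  modulo them.\<close>

lemma no_splitting:
  assumes G_F0: "\<And>x. x \<in> F0 \<Longrightarrow> G x \<in> F0"
    and G_add: "\<And>x y. x \<in> F0 \<Longrightarrow> y \<in> F0 \<Longrightarrow> G (x + y) = G x + G y"
    and G_act: "\<And>x r. x \<in> F0 \<Longrightarrow> r \<in> rcar PA \<Longrightarrow> G (free_act x r) = free_act (G x) r"
    and G_section: "\<And>x. x \<in> F0 \<Longrightarrow> G x - x \<in> relations"
    and G_S: "\<And>x. x \<in> relations \<Longrightarrow> G x = 0"
  shows False
proof -
  have G_diff: "G (x - y) = G x - G y" if "x \<in> F0" "y \<in> F0" for x y
  proof -
    have "G (x - y + y) = G (x - y) + G y" by (rule G_add) (use that in simp_all)
    moreover have "x - y + y = x" by simp
    ultimately show ?thesis by (metis add_diff_cancel_right')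
  qed
  \<comment> \<open>The ordinals in the supports of the images of all generators at
    \<open>\<beta>\<close>: countably many generators, each with finite support.\<close>
  define H where "H \<beta> = (\<Union>b. \<Union>n. (\<lambda>j. fst (snd j)) ` {j. G (gen (b, \<beta>, n)) j \<noteq> 0})" for \<beta>
  have Ggen: "G (gen i) \<in> F0" if "fst (snd i) \<in> Field omega1" for i
    using that by (intro G_F0 gen_F0) (simp add: I0_def)
  have "countable (H \<beta>)" if "\<beta> \<in> Field omega1" for \<beta>
  proof -
    have "finite {j. G (gen (b, \<beta>, n)) j \<noteq> 0}" for b n
      using Ggen[of "(b, \<beta>, n)"] that by (simp add: free_on_def)
    then have "countable ((\<lambda>j. fst (snd j)) ` {j. G (gen (b, \<beta>, n)) j \<noteq> 0})" for b n
      by (intro countable_finite finite_imageI)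
    then show ?thesis unfolding H_def by (intro countable_UN) simp_all
  qed
  moreover have "H \<beta> \<subseteq> Field omega1" if "\<beta> \<in> Field omega1" for \<beta>
  proof
    fix \<gamma> assume "\<gamma> \<in> H \<beta>"
    then obtain b n j where j: "G (gen (b, \<beta>, n)) j \<noteq> 0" "\<gamma> = fst (snd j)"
      unfolding H_def by blast
    then have "j \<in> I0" using free_on_support[OF Ggen[of "(b, \<beta>, n)"], of j] that by simp
    then show "\<gamma> \<in> Field omega1" using j by (simp add: I0_def)
  qed
  ultimately obtain \<delta> where lim: "is_limit \<delta>" and closed: "\<And>b c. olt b \<delta> \<Longrightarrow> c \<in> H b \<Longrightarrow> olt c \<delta>"
    using exists_closed_limit[of H] by metis
  define I where "I = {i :: idx. olt (fst (snd i)) \<delta>}"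
  have I_I0: "I \<subseteq> I0" using olt_Field by (auto simp: I_def I0_def)
  have G_gen_I: "G (gen i) \<in> free_on vert I" if "i \<in> I" for i
  proof -
    have "j \<in> I" if "G (gen i) j \<noteq> 0" for j
      using closed[of "fst (snd i)" "fst (snd j)"] that \<open>i \<in> I\<close>
      by (cases i) (auto simp: I_def H_def)
    then show ?thesis using Ggen[of i] I_I0 that by (auto simp: free_on_def I0_def)
  qed
  define z where "z n = G (gen (True, \<delta>, n))" for n
  have F: "(gen (b, \<delta>, n) :: idx \<Rightarrow> 'v \<times> 'e list \<Rightarrow> 'k) \<in> F0"
    "(gen (b, \<zeta> \<delta> n, n) :: idx \<Rightarrow> 'v \<times> 'e list \<Rightarrow> 'k) \<in> F0" for b n
    using limit_Field[OF lim] ladder_Field[OF ladder lim] by (auto intro!: gen_F0)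
  \<comment> \<open>\<open>G\<close> kills the relator. Its \<open>x\<close> term drops out because
    \<open>\<zeta> \<delta> n\<close> is below \<open>\<delta>\<close>, so the image of that
    generator is supported in \<open>I\<close>.\<close>
  have z_step: "z n i = z (Suc n) i \<star> step n" if i: "i \<notin> I" for n i
  proof -
    have "0 = G (relator \<zeta> \<delta> n)" using G_S[OF relator_S[OF lim]] by simp
    also have "\<dots> = G (gen (True, \<delta>, n)) - free_act (G (gen (True, \<delta>, Suc n))) (step n)
        - G (gen (False, \<zeta> \<delta> n, n))"
      unfolding relator_eq
      using F by (simp add: G_diff G_act)
    finally have e: "0 = G (gen (True, \<delta>, n)) - free_act (G (gen (True, \<delta>, Suc n))) (step n)
        - G (gen (False, \<zeta> \<delta> n, n))" .
    have "z n i - z (Suc n) i \<star> step n - G (gen (False, \<zeta> \<delta> n, n)) i = 0"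
      using fun_cong[OF e[symmetric], of i] by (simp add: z_def free_act_def)
    moreover have "(False, \<zeta> \<delta> n, n) \<in> I" using ladder lim by (simp add: I_def ladder_system_def)
    from G_gen_I[OF this] i have "G (gen (False, \<zeta> \<delta> n, n)) i = 0"
      by (metis free_on_support)
    ultimately have "z n i - z (Suc n) i \<star> step n = 0" by (simp only: diff_zero)
    then show ?thesis by (simp only: right_minus_eq)
  qed
  \<comment> \<open>By \<open>z_step\<close>, each \<open>z n i\<close> is right divisible by
    products of arbitrarily many nontrivial paths.\<close>
  have z_length: "k \<le> length (snd p)" if "i \<notin> I" "z n i p \<noteq> 0" for i n p k
    using that(2)
  proof (induction k arbitrary: n p)
    case (Suc k)
    from Suc.prems have "(z (Suc n) i \<star> pbasis (w (Suc n)) (es n)) p \<noteq> 0"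
      unfolding z_step[OF that(1), of n] step_def .
    then show ?case
      by (rule mult_pbasis_length[where f = "z (Suc n) i" and n = k, rotated 2])
        (erule Suc.IH, rule es_nonempty)
  qed simp
  have z_zero: "z n i = 0" if "i \<notin> I" for n i
  proof (rule ext, rule ccontr)
    fix p assume "z n i p \<noteq> 0 p"
    then show False using z_length[OF that, of n p "Suc (length (snd p))"] by simp
  qed
  obtain b where b: "b \<in> F1" and Gb: "G (gen (True, \<delta>, 0)) - gen (True, \<delta>, 0) = d0 b"
    using G_section[OF F(1)] unfolding relations_def by blast
  have eq: "z 0 i - gen (True, \<delta>, 0) i = d0 b i" for i
    using fun_cong[OF Gb, of i] by (simp add: z_def)
  have notI: "(True, \<delta>, n) \<notin> I" for n by (simp add: I_def)
  \<comment> \<open>At the coordinates over \<open>\<delta>\<close> the image of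
    \<open>y \<delta> 0\<close> vanishes. Hence \<open>b\<close> starts with minus a trivial path,
    and each later entry is \<open>step n\<close> times the previous one; this contradicts finite
    support.\<close>
  have nz: "b (True, \<delta>, n) \<noteq> 0" for n
  proof (induction n)
    case 0
    have "pbasis (w 0) [] \<noteq> (0 :: _ \<Rightarrow> 'k)"
    proof
      assume "pbasis (w 0) [] = (0 :: _ \<Rightarrow> 'k)"
      from fun_cong[OF this, of "(w 0, [])"] show False by (simp add: pbasis_def)
    qed
    moreover have "b (True, \<delta>, 0) = - pbasis (w 0) []"
      using d0_coord[OF b, of \<delta>] eq[of "(True, \<delta>, 0)"] z_zero[OF notI[of 0], of 0]
      by (simp add: gen_def single_def)
    ultimately have "b (True, \<delta>, 0) \<noteq> 0" by simp
    then show ?case .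
  next
    case (Suc n)
    have "b (True, \<delta>, n) \<in> ideal_at (w n)" using free_on_apply[OF b, of "(True, \<delta>, n)"] by simp
    then have "step n \<star> b (True, \<delta>, n) \<noteq> 0" using Suc by (intro step_mult_nonzero)
    moreover have "b (True, \<delta>, Suc n) - step n \<star> b (True, \<delta>, n) = 0"
      using d0_coord[OF b, of \<delta> n] eq[of "(True, \<delta>, Suc n)"] z_zero[OF notI[of "Suc n"], of 0]
      by (simp add: gen_def single_def)
    ultimately have "b (True, \<delta>, Suc n) \<noteq> 0" by simp
    then show ?case .
  qed
  have "finite {i. b i \<noteq> 0}" using b by (simp add: free_on_def)
  moreover have "range (\<lambda>n. (True, \<delta>, n)) \<subseteq> {i. b i \<noteq> 0}" using nz by blast
  ultimately have "finite (range (\<lambda>n :: nat. (True, \<delta>, n)))" using finite_subset by blast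
  then show False by (auto dest!: finite_imageD simp: inj_on_def)
qed

section \<open>Extending homomorphisms by uniformization\<close>

lemma free_hom_regular_diff:
  assumes "free_hom u I (regular_module PA) g" "x \<in> free_on u I" "y \<in> free_on u I"
  shows "g (x - y) = g x - g y"
proof -
  have "g (x - y + y) = g (x - y) + g y"
    using free_hom_add[OF assms(1) free_on_diff[OF assms(2,3)] assms(3)] by simp
  moreover have "x - y + y = x" by simp
  ultimately show ?thesis by (metis add_diff_cancel_right')
qed

lemma backward_recursion:
  fixes s :: "nat \<Rightarrow> 'v \<times> 'e list \<Rightarrow> 'k"
  assumes s: "\<And>n. s n \<in> rcar PA" and N: "\<And>n. n \<ge> N \<Longrightarrow> s n = 0"
  shows "\<exists>t. \<forall>n. t n \<in> rcar PA \<and> t n = s n + t (Suc n) \<star> step n"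
proof -
  \<comment> \<open>\<open>T k\<close> is the solution at index \<open>N - k\<close>, starting from
    zero at \<open>N\<close>; truncated subtraction makes it zero beyond \<open>N\<close> as
    well.\<close>
  define T where "T = rec_nat (0 :: 'v \<times> 'e list \<Rightarrow> 'k) (\<lambda>k a. s (N - Suc k) + a \<star> step (N - Suc k))"
  have T0: "T 0 = 0" and TS: "T (Suc k) = s (N - Suc k) + T k \<star> step (N - Suc k)" for k
    by (simp_all add: T_def)
  have Tc: "T k \<in> rcar PA" for k
  proof (induction k)
    case 0
    show ?case unfolding T0 by (rule carrier_zero)
  next
    case (Suc k)
    then show ?case unfolding TS
      by (intro carrier_add s pmul_closed ideal_at_carrier[OF step_ideal_at])
  qed
  have "T (N - n) = s n + T (N - Suc n) \<star> step n" for n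
  proof (cases "n < N")
    case True
    then have m: "N - n = Suc (N - Suc n)" "N - Suc (N - Suc n) = n" by auto
    show ?thesis unfolding m(1) TS m(2) ..
  next
    case False
    then have m: "N - n = 0" "N - Suc n = 0" by auto
    show ?thesis unfolding m T0 using N[of n] False by simp
  qed
  with Tc show ?thesis by (intro exI[of _ "\<lambda>n. T (N - n)"] allI conjI)
qed

text \<open>Factoring \<open>\<phi>\<close> through \<open>d0\<close> means solving \<open>c
  \<alpha> n = Y \<alpha> n - Y \<alpha> (n + 1) \<star> step n - t (\<zeta> \<alpha> n) n\<close>,
  where \<open>Y\<close> and \<open>t\<close> are the images of the generators. Uniformization gives
  a \<open>t\<close> for which \<open>Y = 0\<close> works on a tail.\<close>

lemma extend_hom:
  assumes K: "countable (UNIV :: 'k set)" and paths: "\<And>n. countable (paths_ending_in src tgt (w n))"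
    and UP and phi: "free_hom vert I1 (regular_module PA) \<phi>"
  shows "\<exists>\<psi>. free_hom vert I0 (regular_module PA) \<psi> \<and> (\<forall>x\<in>F1. \<phi> x = \<psi> (d0 x))"
proof -
  define c where "c \<alpha> n = \<phi> (gen (True, \<alpha>, n))" for \<alpha> n
  have gen_F1: "gen (True, \<alpha>, n) \<in> F1" if "is_limit \<alpha>" for \<alpha> n
    using that by (simp add: gen_def)
  have c_car: "c \<alpha> n \<in> rcar PA" if "is_limit \<alpha>" for \<alpha> n
    using free_hom_closed[OF phi gen_F1[OF that]] by (simp add: c_def)
  have phi_single: "\<phi> (single (True, \<alpha>, n) a) = c \<alpha> n \<star> a" if "is_limit \<alpha>" "a \<in> ideal_at (w n)" for \<alpha> n a
    using free_hom_act[OF phi gen_F1[OF that(1), of n] ideal_at_carrier[OF that(2)]]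
      single_generator[of a vert "(True, \<alpha>, n)"] that(2) by (simp add: c_def gen_def)
  define L where "L n = {f :: 'v \<times> 'e list \<Rightarrow> 'k. f \<in> rcar PA \<and> (\<forall>u l. f (u, l) \<noteq> 0 \<longrightarrow> qend tgt u l = w n)}" for n
  \<comment> \<open>One ordinal may sit at different positions in different ladders, so a colour
    records the position \<open>n\<close> together with the element.\<close>
  define D where "D = Sigma UNIV L"
  have D: "countable D" unfolding D_def L_def
    by (intro countable_SIGMA countable_left_ideal[OF K paths]) simp
  have c_D: "(n, c \<alpha> n) \<in> D" if "is_limit \<alpha>" for \<alpha> n
  proof -
    have "c \<alpha> n = c \<alpha> n \<star> pbasis (w n) []"
      using phi_single[OF that pbasis_Nil_ideal_at, of n] by (simp add: c_def gen_def)
    then have "qend tgt u l = w n" if "c \<alpha> n (u, l) \<noteq> 0" for u l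
      using mult_pbasis_Nil_end that by metis
    then show ?thesis using c_car[OF that] by (simp add: D_def L_def)
  qed
  have D_car: "a \<in> rcar PA" if "(n, a) \<in> D" for n a using that by (simp add: D_def L_def)
  \<comment> \<open>A colour depends on a point of the ladder, so its position is recovered by
    choice; it is unique since ladders are injective.\<close>
  define d where "d \<alpha> \<beta> = (let n = SOME n. \<zeta> \<alpha> n = \<beta> in to_nat_on D (n, c \<alpha> n))" for \<alpha> \<beta>
  have d: "d \<alpha> (\<zeta> \<alpha> n) = to_nat_on D (n, c \<alpha> n)" if "is_limit \<alpha>" for \<alpha> n
  proof -
    have "(SOME m. \<zeta> \<alpha> m = \<zeta> \<alpha> n) = n"
      using ladder_system_inj[OF ladder that] by (intro some_equality) auto
    then show ?thesis by (simp add: d_def)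
  qed
  obtain f where f: "\<And>\<alpha>. is_limit \<alpha> \<Longrightarrow> \<exists>N. \<forall>n\<ge>N. f (\<zeta> \<alpha> n) = d \<alpha> (\<zeta> \<alpha> n)"
    using \<open>UP\<close>[unfolded UP_def, rule_format, of \<zeta> "\<lambda>_. UNIV" d] ladder by auto
  have "(0, 0) \<in> D" by (simp add: D_def L_def)
  then have D_ne: "D \<noteq> {}" by blast
  \<comment> \<open>The sign is that of the \<open>x\<close> term in the relator. Only the generator
    at the recorded position gets a value; the others at \<open>\<beta>\<close> go to zero.\<close>
  define t where "t \<beta> n = (case from_nat_into D (f \<beta>) of (m, a) \<Rightarrow> if m = n then - a else 0)" for \<beta> n
  have t_car: "t \<beta> n \<in> rcar PA" for \<beta> n
  proof (cases "from_nat_into D (f \<beta>)")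
    case (Pair m a)
    then have "a \<in> rcar PA" using from_nat_into[OF D_ne, of "f \<beta>"] D_car by simp
    then show ?thesis using Pair by (simp add: t_def carrier_minus)
  qed
  have t_c: "\<exists>N. \<forall>n\<ge>N. c \<alpha> n + t (\<zeta> \<alpha> n) n = 0" if lim: "is_limit \<alpha>" for \<alpha>
  proof -
    obtain N where N: "\<And>n. n \<ge> N \<Longrightarrow> f (\<zeta> \<alpha> n) = to_nat_on D (n, c \<alpha> n)"
      using f[OF lim] d[OF lim] by auto
    have "t (\<zeta> \<alpha> n) n = - c \<alpha> n" if "n \<ge> N" for n
      using N[OF that] from_nat_into_to_nat_on[OF D c_D[OF lim, of n]] by (simp add: t_def)
    then show ?thesis by (metis add.right_inverse)
  qed
  \<comment> \<open>Only finitely many equations for each \<open>\<alpha>\<close> still have a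
    nonzero defect, and the downward recursion absorbs it into the
    \<open>y \<alpha> n\<close>.\<close>
  have "\<exists>y. is_limit \<alpha> \<longrightarrow> (\<forall>n. y n \<in> rcar PA \<and> y n = (c \<alpha> n + t (\<zeta> \<alpha> n) n) + y (Suc n) \<star> step n)" for \<alpha>
  proof (cases "is_limit \<alpha>")
    case True
    obtain N where "\<And>n. n \<ge> N \<Longrightarrow> c \<alpha> n + t (\<zeta> \<alpha> n) n = 0" using t_c[OF True] by blast
    then show ?thesis
      using backward_recursion[of "\<lambda>n. c \<alpha> n + t (\<zeta> \<alpha> n) n" N] carrier_add[OF c_car[OF True] t_car] by blast
  qed simp
  then obtain Y where Y_car: "\<And>\<alpha> n. is_limit \<alpha> \<Longrightarrow> Y \<alpha> n \<in> rcar PA"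
    and Y: "\<And>\<alpha> n. is_limit \<alpha> \<Longrightarrow> Y \<alpha> n = (c \<alpha> n + t (\<zeta> \<alpha> n) n) + Y \<alpha> (Suc n) \<star> step n"
    by metis
  define V where "V i = (case i of (b, \<beta>, n) \<Rightarrow> if b then if is_limit \<beta> then Y \<beta> n else 0 else t \<beta> n)" for i :: idx
  have "V i \<in> mcar (regular_module PA)" for i
    using Y_car t_car by (cases i) (simp add: V_def)
  then obtain \<psi> where psi: "free_hom vert I0 (regular_module PA) \<psi>"
    and psi_single: "\<And>i a. i \<in> I0 \<Longrightarrow> a \<in> ideal_at (vert i) \<Longrightarrow> \<psi> (single i a) = V i \<star> a"
    using free_lift[OF premodule_regular, where u = vert and I = I0 and n = V] by auto
  have "\<phi> x = \<psi> (d0 x)" if "x \<in> F1" for x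
    using that
  proof (induction x rule: free_on_induct)
    case zero
    have "\<phi> 0 = \<psi> (d0 0)"
      using free_hom_zero[OF premodule_regular phi] free_hom_zero[OF premodule_regular psi]
      by (simp add: d0_zero)
    then show ?case .
  next
    case (single i a)
    obtain \<alpha> n where i: "i = (True, \<alpha>, n)" and lim: "is_limit \<alpha>" using single(1) by (cases i) auto
    have a: "a \<in> ideal_at (w n)" using single(2) i by simp
    have sa: "step n \<star> a \<in> ideal_at (w (Suc n))" by (rule step_mult_ideal_at[OF ideal_at_carrier[OF a]])
    note lF = limit_Field[OF lim] ladder_Field[OF ladder lim]
    have "\<psi> (d0 (single i a)) = \<psi> (single (True, \<alpha>, n) a) - \<psi> (single (True, \<alpha>, Suc n) (step n \<star> a))
        - \<psi> (single (False, \<zeta> \<alpha> n, n) a)"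
      unfolding i d0_single[OF lim a] relator_act[OF a]
      using a sa lF by (simp add: free_hom_regular_diff[OF psi])
    also have "\<dots> = Y \<alpha> n \<star> a - Y \<alpha> (Suc n) \<star> (step n \<star> a) - t (\<zeta> \<alpha> n) n \<star> a"
      using a sa lF lim by (simp add: psi_single V_def)
    also have "\<dots> = (Y \<alpha> n - Y \<alpha> (Suc n) \<star> step n - t (\<zeta> \<alpha> n) n) \<star> a"
      by (simp add: pmul_diff_left pmul_assoc)
    also have "Y \<alpha> n - Y \<alpha> (Suc n) \<star> step n - t (\<zeta> \<alpha> n) n = c \<alpha> n"
      using Y[OF lim, of n] by (simp add: algebra_simps)
    finally show ?case using phi_single[OF lim a] i by simp
  next
    case (add x y)
    have "\<phi> (x + y) = \<psi> (d0 x + d0 y)"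
      using free_hom_add[OF phi add(1,2)] free_hom_add[OF psi d0_F0[OF add(1)] d0_F0[OF add(2)]] add(3,4)
      by simp
    then have "\<phi> (x + y) = \<psi> (d0 (x + y))" unfolding d0_add[OF add(1,2)] .
    then show ?case .
  qed
  then show ?thesis using psi by blast
qed

end

section \<open>The quotient module and its resolution\<close>

context presentation
begin

text \<open>Names the coset of \<open>x\<close> by one of its elements, so the quotient lives in the
  type of the free modules. Congruent elements have the same candidates, hence the same
  choice.\<close>

definition coset_rep :: "(idx \<Rightarrow> 'v \<times> 'e list \<Rightarrow> 'k) \<Rightarrow> idx \<Rightarrow> 'v \<times> 'e list \<Rightarrow> 'k" where
  "coset_rep x = (SOME y. y - x \<in> relations)"

lemma coset_rep_diff: "coset_rep x - x \<in> relations"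
proof -
  have "x - x \<in> relations" using relations_zero by simp
  then show ?thesis unfolding coset_rep_def by (rule someI[where P = "\<lambda>y. y - x \<in> relations"])
qed

lemma coset_rep_eq_iff: "coset_rep x = coset_rep y \<longleftrightarrow> x - y \<in> relations"
proof
  assume "coset_rep x = coset_rep y"
  then have "coset_rep x - x \<in> relations" "coset_rep x - y \<in> relations" using coset_rep_diff[of x] coset_rep_diff[of y] by simp_all
  then have "(coset_rep x - y) - (coset_rep x - x) \<in> relations" by (rule relations_diff[rotated])
  then show "x - y \<in> relations" by simp
next
  assume xy: "x - y \<in> relations"
  have "z - x \<in> relations \<longleftrightarrow> z - y \<in> relations" for z
  proof
    assume "z - x \<in> relations"
    then have "(z - x) + (x - y) \<in> relations" using xy by (rule relations_add)
    then show "z - y \<in> relations" by simp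
  next
    assume "z - y \<in> relations"
    then have "(z - y) - (x - y) \<in> relations" using xy by (rule relations_diff)
    then show "z - x \<in> relations" by simp
  qed
  then show "coset_rep x = coset_rep y" by (simp add: coset_rep_def)
qed

text \<open>The module is the cokernel of the injective map \<open>d0\<close>, so \<open>F1\<close>
  and \<open>F0\<close> resolve it in length one. The map \<open>enc\<close> moves everything into
  the single type that \<open>Ext_vanish\<close> requires.\<close>

lemma counterexample:
  fixes enc :: "(idx \<Rightarrow> 'v \<times> 'e list \<Rightarrow> 'k) \<Rightarrow> 'm"
  assumes enc: "inj enc"
    and K: "countable (UNIV :: 'k set)" and paths: "\<And>n. countable (paths_ending_in src tgt (w n))"
    and UP
  shows "\<exists>M :: ('m, 'v \<times> 'e list \<Rightarrow> 'k) rmod.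
    rmodule PA M \<and> Ext_vanish PA M (regular_module PA) \<and> \<not> projective PA M"
proof -
  define qM where "qM x = enc (coset_rep x)" for x
  have qM_eq: "qM x = qM y \<longleftrightarrow> x - y \<in> relations" for x y
    using coset_rep_eq_iff[of x y] enc by (simp add: qM_def inj_eq)
  have enc_eq: "enc x = enc y \<longleftrightarrow> x = y" for x y using enc by (rule inj_eq)
  interpret P0: free_image src tgt vert I0 enc
    by unfold_locales (simp_all only: enc_eq)
  interpret P1: free_image src tgt vert I1 enc
    by unfold_locales (simp_all only: enc_eq)
  interpret Z: free_image src tgt vert "{}" enc
    by unfold_locales (simp_all only: enc_eq)
  interpret M: free_image src tgt vert I0 qM
  proof unfold_locales
    fix x x' y :: "idx \<Rightarrow> 'v \<times> 'e list \<Rightarrow> 'k" assume "qM x = qM x'"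
    then show "qM (x + y) = qM (x' + y)" unfolding qM_eq by simp
  next
    fix x x' :: "idx \<Rightarrow> 'v \<times> 'e list \<Rightarrow> 'k" and r :: "'v \<times> 'e list \<Rightarrow> 'k"
    assume "r \<in> rcar PA" "qM x = qM x'"
    then show "qM (free_act x r) = qM (free_act x' r)"
      unfolding qM_eq using relations_act[of "x - x'" r] by (simp only: free_act_diff)
  qed
  have rep0: "P0.rep (enc x) = x" if "x \<in> F0" for x
    by (rule inv_into_f_f) (use that enc in \<open>auto intro: inj_on_subset\<close>)
  have rep1: "P1.rep (enc x) = x" if "x \<in> F1" for x
    by (rule inv_into_f_f) (use that enc in \<open>auto intro: inj_on_subset\<close>)
  have inj_on: "inj_on enc A" for A using enc by (rule inj_on_subset) simp
  \<comment> \<open>Copies of \<open>F0\<close> and \<open>F1\<close>, followed by the zero module,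
    which is the free module on no generators.\<close>
  define P where "P n = (case n of 0 \<Rightarrow> P0.Mod | Suc 0 \<Rightarrow> P1.Mod | Suc (Suc _) \<Rightarrow> Z.Mod)" for n :: nat
  have P: "P 0 = P0.Mod" "P (Suc 0) = P1.Mod" "P (Suc (Suc n)) = Z.Mod" for n
    by (simp_all add: P_def)
  define D where "D n = (case n of 0 \<Rightarrow> (\<lambda>a. enc (d0 (P1.rep a))) | Suc _ \<Rightarrow> (\<lambda>_. enc 0))" for n :: nat
  have D: "D 0 = (\<lambda>a. enc (d0 (P1.rep a)))" "D (Suc n) = (\<lambda>_. enc 0)" for n
    by (simp_all add: D_def)
  define eps where "eps a = qM (P0.rep a)" for a
  have free_empty: "free_on vert {} = {0 :: idx \<Rightarrow> 'v \<times> 'e list \<Rightarrow> 'k}"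
  proof (intro equalityI subsetI)
    fix x :: "idx \<Rightarrow> 'v \<times> 'e list \<Rightarrow> 'k" assume "x \<in> free_on vert {}"
    then have "x i = 0" for i using free_on_support by (metis empty_iff)
    then have "x = 0" by (intro ext) simp
    then show "x \<in> {0}" unfolding singleton_iff .
  qed simp
  have Z_car: "mcar Z.Mod = {enc 0}" by (simp add: free_empty)
  have eps_q: "free_hom vert I0 M.Mod (\<lambda>x. eps (enc x))"
    using M.free_hom_q P0.free_hom_cong[of "\<lambda>x. eps (enc x)" qM M.Mod] rep0 by (simp add: eps_def)
  have d0_q: "free_hom vert I1 P0.Mod (\<lambda>x. D 0 (enc x))"
    unfolding free_hom_def
    using rep1 d0_F0 d0_add d0_act by (simp add: D)
  have zero_hom: "mhom PA X Y (\<lambda>_. mzero Y)" if "premodule PA Y" for X :: "('m, 'v \<times> 'e list \<Rightarrow> 'k) rmod" and Y :: "('n, 'v \<times> 'e list \<Rightarrow> 'k) rmod"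
    using that premodule.act_zero_left[OF that] unfolding mhom_def
    by (simp add: premodule.zero_closed premodule.add_zero)
  have P_premodule: "premodule PA (P n)" for n
    using P0.premodule_Mod P1.premodule_Mod Z.premodule_Mod by (simp add: P_def split: nat.split)
  have P_zero: "mzero (P n) = enc 0" for n
    by (simp add: P_def split: nat.split)
  have "proj_resolution PA M.Mod P D eps"
    unfolding proj_resolution_def
  proof (intro conjI allI)
    show "projective PA (P i)" for i
      using P0.projective_Mod P1.projective_Mod Z.projective_Mod inj_on by (simp add: P_def split: nat.split)
    show "mhom PA (P 0) M.Mod eps"
      using eps_q by (simp add: P P0.mhom_Mod_iff)
    show "eps ` mcar (P 0) = mcar M.Mod"
      by (auto simp: P eps_def rep0 image_image cong: image_cong)
    show "mhom PA (P (Suc i)) (P i) (D i)" for i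
    proof (cases i)
      case 0
      then show ?thesis using d0_q by (simp add: P P1.mhom_Mod_iff)
    next
      case (Suc j)
      then show ?thesis using zero_hom[OF P_premodule[of i], of "P (Suc i)"] P_zero by (simp add: D)
    qed
    show "{x \<in> mcar (P 0). eps x = mzero M.Mod} = D 0 ` mcar (P 1)"
    proof -
      \<comment> \<open>The kernel of \<open>eps\<close> consists of the codes of elements congruent
        to zero, that is, of the relations.\<close>
      have "{x \<in> mcar (P 0). eps x = mzero M.Mod} = enc ` {y \<in> F0. qM y = qM 0}"
        using rep0 by (auto simp: P eps_def)
      also have "{y \<in> F0. qM y = qM 0} = d0 ` F1"
        unfolding qM_eq using relations_F0 by (auto simp: relations_def)
      also have "enc ` d0 ` F1 = D 0 ` mcar (P 1)"
        using rep1 by (auto simp: P D image_image cong: image_cong)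
      finally show ?thesis .
    qed
    show "{x \<in> mcar (P (Suc i)). D i x = mzero (P i)} = D (Suc i) ` mcar (P (Suc (Suc i)))" for i
    proof (cases i)
      case 0
      have "D 0 (enc y) = enc 0 \<longleftrightarrow> y = 0" if "y \<in> F1" for y
        using that rep1 d0_eq_zero_iff by (simp add: D enc_eq)
      then have "{x \<in> enc ` F1. D 0 x = enc 0} = {enc 0}" using free_on_zero by auto
      then show ?thesis unfolding 0 P P_zero D(2) Z_car by (simp add: P1.mcar_Mod P0.mzero_Mod)
    next
      case (Suc j)
      then show ?thesis unfolding Suc P D Z_car P_zero by auto
    qed
  qed
  moreover have "\<exists>\<psi>. mhom PA (P (n - 1)) (regular_module PA) \<psi> \<and> (\<forall>x\<in>mcar (P n). \<phi> x = \<psi> (D (n - 1) x))"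
    if n: "n \<ge> 1" and phi: "mhom PA (P n) (regular_module PA) \<phi>" for n \<phi>
  proof (cases "n = 1")
    case True
    have "free_hom vert I1 (regular_module PA) (\<lambda>x. \<phi> (enc x))"
      using phi unfolding True One_nat_def P P1.mhom_Mod_iff .
    then obtain \<psi> where psi: "free_hom vert I0 (regular_module PA) \<psi>" "\<And>x. x \<in> F1 \<Longrightarrow> \<phi> (enc x) = \<psi> (d0 x)"
      using extend_hom[OF K paths \<open>UP\<close>] by blast
    have "free_hom vert I0 (regular_module PA) (\<lambda>x. \<psi> (P0.rep (enc x)))"
      using psi(1) P0.free_hom_cong[of "\<lambda>x. \<psi> (P0.rep (enc x))" \<psi>] rep0 by simp
    then show ?thesis
      using psi(2) rep0 rep1 d0_F0
      by (intro exI[of _ "\<lambda>a. \<psi> (P0.rep a)"]) (auto simp: True P D P0.mhom_Mod_iff)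
  next
    \<comment> \<open>From degree two on the resolution is zero, so the cocycle itself is
      zero.\<close>
    case False
    then obtain m where m: "n = Suc (Suc m)" using n by (cases n; cases "n - 1") auto
    have "\<phi> (enc 0) = 0"
      using mhom_zero[OF P_premodule premodule_regular phi] P_zero by simp
    then show ?thesis
      using zero_hom[OF premodule_regular, of "P (n - 1)"]
      by (intro exI[of _ "\<lambda>_. 0"]) (simp add: m P Z_car free_empty)
  qed
  ultimately have Ext: "Ext_vanish PA M.Mod (regular_module PA)"
    unfolding Ext_vanish_def by blast
  have "\<not> projective PA M.Mod"
  proof
    assume proj: "projective PA M.Mod"
    \<comment> \<open>Projectivity is tested on modules whose carriers are sets of functions on
      \<open>'m\<close>, so \<open>F0\<close> is copied there by means of indicator
      functions.\<close>
    define j :: "'m \<Rightarrow> 'm \<Rightarrow> 'v \<times> 'e list \<Rightarrow> 'k" where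
      "j m = (\<lambda>m' p. if m' = m then 1 else 0)" for m
    have j: "j m = j m' \<longleftrightarrow> m = m'" for m m'
      by (auto simp: j_def fun_eq_iff split: if_splits)
    define enc' where "enc' x = j (enc x)" for x
    have enc'_eq: "enc' x = enc' y \<longleftrightarrow> x = y" for x y by (simp only: enc'_def j enc_eq)
    interpret N: free_image src tgt vert I0 enc'
      by unfold_locales (simp_all only: enc'_eq)
    have repN: "N.rep (enc' x) = x" if "x \<in> F0" for x
      by (rule inv_into_f_f) (use that enc'_eq in \<open>auto intro: inj_onI\<close>)
    define f where "f a = qM (N.rep a)" for a
    have f: "f (enc' x) = qM x" if "x \<in> F0" for x using repN[OF that] by (simp add: f_def)
    have "free_hom vert I0 M.Mod (\<lambda>x. f (enc' x))"
      using M.free_hom_q N.free_hom_cong[of "\<lambda>x. f (enc' x)" qM M.Mod] f by simp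
    then have "mhom PA N.Mod M.Mod f" by (simp add: N.mhom_Mod_iff)
    moreover have "f ` mcar N.Mod = mcar M.Mod"
      by (auto simp: f image_image cong: image_cong)
    ultimately obtain g where g: "mhom PA M.Mod N.Mod g" and fg: "\<forall>x\<in>mcar M.Mod. f (g x) = x"
      using proj N.rmodule_Mod unfolding projective_def by blast
    have gq: "free_hom vert I0 N.Mod (\<lambda>x. g (qM x))" using g unfolding M.mhom_Mod_iff .
    \<comment> \<open>The section \<open>g\<close> after the quotient map, read back as an
      endomorphism of \<open>F0\<close>.\<close>
    define G where "G x = N.rep (g (qM x))" for x
    have gq_car: "g (qM x) \<in> enc' ` F0" if "x \<in> F0" for x
      using free_hom_closed[OF gq that] by simp
    have G_F0: "G x \<in> F0" if "x \<in> F0" for x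
      unfolding G_def by (rule inv_into_into[OF gq_car[OF that]])
    have G: "enc' (G x) = g (qM x)" if "x \<in> F0" for x
      unfolding G_def by (rule f_inv_into_f[OF gq_car[OF that]])
    show False
    proof (rule no_splitting[of G])
      show "G x \<in> F0" if "x \<in> F0" for x by (rule G_F0[OF that])
      show "G (x + y) = G x + G y" if "x \<in> F0" "y \<in> F0" for x y
      proof -
        have "enc' (G (x + y)) = madd N.Mod (enc' (G x)) (enc' (G y))"
          using free_hom_add[OF gq that] G[OF that(1)] G[OF that(2)] G[OF free_on_add[OF that]] by simp
        also have "\<dots> = enc' (G x + G y)" by (rule N.madd_Mod[OF G_F0 G_F0]) (use that in simp_all)
        finally show ?thesis unfolding enc'_eq .
      qed
      show "G (free_act x r) = free_act (G x) r" if "x \<in> F0" "r \<in> rcar PA" for x r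
      proof -
        have "enc' (G (free_act x r)) = mact N.Mod (enc' (G x)) r"
          using free_hom_act[OF gq that] G[OF that(1)] G[OF free_on_act[OF that]] by simp
        also have "\<dots> = enc' (free_act (G x) r)" by (rule N.mact_Mod[OF G_F0 that(2)]) (rule that(1))
        finally show ?thesis unfolding enc'_eq .
      qed
      show "G x - x \<in> relations" if "x \<in> F0" for x
      proof -
        have "qM (G x) = f (g (qM x))" using f[OF G_F0[OF that]] G[OF that] by simp
        also have "\<dots> = qM x" using fg that by simp
        finally show ?thesis unfolding qM_eq .
      qed
      show "G x = 0" if "x \<in> relations" for x
      proof -
        have "x - 0 \<in> relations" using that by simp
        then have "qM x = qM 0" unfolding qM_eq .
        then have "enc' (G x) = enc' 0"
          using G[OF relations_F0[OF that]] free_hom_zero[OF N.premodule_Mod gq] by simp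
        then show ?thesis unfolding enc'_eq .
      qed
    qed
  qed
  then show ?thesis using M.rmodule_Mod Ext by blast
qed

end

section \<open>From the given quiver to a sequence of paths, and the encoding\<close>

context quiver
begin

text \<open>A cycle gives the constant vertex \<open>v\<close> with the whole cycle as every path; a
  ray gives its arrows as paths of length one.\<close>

lemma exists_ray:
  assumes "has_oriented_cycle_through src tgt v \<or> has_incoming_ray_at src tgt v"
  shows "\<exists>w es. w 0 = v \<and> ray_quiver src tgt w es"
  using assms
proof
  assume "has_oriented_cycle_through src tgt v"
  then obtain c where "c \<noteq> []" "qwalk src tgt v c" "qend tgt v c = v"
    by (auto simp: has_oriented_cycle_through_def)
  then show ?thesis
    by (intro exI[of _ "\<lambda>_. v"] exI[of _ "\<lambda>_. c"]) (simp add: ray_quiver_def)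
next
  assume "has_incoming_ray_at src tgt v"
  then obtain w a where "w 0 = v" "\<And>n. src (a n) = w (Suc n)" "\<And>n. tgt (a n) = w n"
    by (auto simp: has_incoming_ray_at_def)
  then show ?thesis
    by (intro exI[of _ w] exI[of _ "\<lambda>n. [a n]"]) (simp add: ray_quiver_def)
qed

end

text \<open>Appending \<open>es n\<close> injects the paths ending in \<open>w (Suc n)\<close> into
  those ending in \<open>w n\<close>.\<close>

lemma (in ray_quiver) countable_paths_ending_in:
  assumes "countable (paths_ending_in src tgt (w 0))"
  shows "countable (paths_ending_in src tgt (w n))"
proof (induction n)
  case 0
  show ?case using assms .
next
  case (Suc n)
  have "(\<lambda>(u, l). (u, l @ es n)) ` paths_ending_in src tgt (w (Suc n)) \<subseteq> paths_ending_in src tgt (w n)"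
    by (auto simp: paths_ending_in_def is_qpath_def qwalk_append qend_append es_walk es_end)
  then have "countable ((\<lambda>(u, l). (u, l @ es n)) ` paths_ending_in src tgt (w (Suc n)))"
    using Suc countable_subset by blast
  then show ?case by (rule countable_image_inj_on) (auto simp: inj_on_def)
qed

text \<open>Countability of the field lets the coefficients be stored inside the sets of naturals.\<close>
lemma exists_encoding:
  assumes "countable (UNIV :: 'k::zero set)"
  shows "\<exists>enc :: (idx \<Rightarrow> 'v \<times> 'e \<Rightarrow> 'k) \<Rightarrow> ('v \<times> 'e \<times> nat set) set. inj enc"
proof -
  obtain h :: "'k \<Rightarrow> nat" where h: "inj h" using assms by (auto simp: countable_def)
  define num where "num b n k = prod_encode (n, prod_encode (of_bool b, h k))" for b :: bool and n :: nat and k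
  have num: "num b n k = num b' n' k' \<longleftrightarrow> b = b' \<and> n = n' \<and> k = k'" for b b' n n' k k'
    using h by (auto simp: num_def prod_encode_eq inj_eq)
  \<comment> \<open>The even numbers carry the set \<open>\<beta>\<close>; the single odd element
    carries the rest of the index and the coefficient.\<close>
  define code where "code i k = (case i of (b, \<beta>, n) \<Rightarrow> (\<lambda>m. 2 * m) ` \<beta> \<union> {Suc (2 * num b n k)})"
    for i :: idx and k
  have even: "2 * m \<in> code (b, \<beta>, n) k \<longleftrightarrow> m \<in> \<beta>" for m b \<beta> n k
    unfolding code_def by auto presburger
  have odd: "Suc (2 * m) \<in> code (b, \<beta>, n) k \<longleftrightarrow> m = num b n k" for m b \<beta> n k
    unfolding code_def by auto presburger
  have code: "i = i' \<and> k = k'" if "code i k = code i' k'" for i i' k k'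
  proof -
    obtain b \<beta> n b' \<beta>' n' where i: "i = (b, \<beta>, n)" "i' = (b', \<beta>', n')" by (cases i, cases i')
    have "\<beta> = \<beta>'" using even[of _ b \<beta> n k] even[of _ b' \<beta>' n' k'] that i by blast
    moreover have "num b n k = num b' n' k'"
      using odd[of _ b \<beta> n k] odd[of _ b' \<beta>' n' k'] that i by blast
    ultimately show ?thesis using i num by simp
  qed
  \<comment> \<open>The graph of \<open>x\<close> over its support, with index and coefficient
    packed into one set of naturals.\<close>
  define enc where "enc x = {(u, l, code i (x i (u, l))) |i u l. x i (u, l) \<noteq> 0}"
    for x :: "idx \<Rightarrow> 'v \<times> 'e \<Rightarrow> 'k"
  have enc: "(u, l, code i k) \<in> enc x \<longleftrightarrow> x i (u, l) = k \<and> k \<noteq> 0" for u l i k x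
    unfolding enc_def using code by blast
  have "inj enc"
  proof (rule injI, rule ext, rule ext, clarify)
    fix x y i u l assume "enc x = enc y"
    then have "x i (u, l) = k \<and> k \<noteq> 0 \<longleftrightarrow> y i (u, l) = k \<and> k \<noteq> 0" for k
      using enc by blast
    then show "x i (u, l) = y i (u, l)" by metis
  qed
  then show ?thesis by blast
qed

theorem theorem2p10:
  fixes src tgt :: "'e \<Rightarrow> 'v" and v :: 'v
  assumes "countable (UNIV :: 'k::alg_closed_field set)"
    and "has_oriented_cycle_through src tgt v \<or> has_incoming_ray_at src tgt v"
    and "countable (paths_ending_in src tgt v)"
    and "UP"
  shows "\<not> (\<forall>M :: (('v \<times> 'e list \<times> nat set) set, 'v \<times> 'e list \<Rightarrow> 'k) rmod.
              rmodule (path_algebra src tgt) M \<and>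
              Ext_vanish (path_algebra src tgt) M (regular_module (path_algebra src tgt)) \<longrightarrow>
              projective (path_algebra src tgt) M)"
proof -
  obtain w es where w: "w 0 = v" and "ray_quiver src tgt w es"
    using quiver.exists_ray[OF assms(2)] by blast
  then interpret ray_quiver src tgt w es by simp
  \<comment> \<open>Any ladder system will do: \<open>UP\<close> speaks of all of them.\<close>
  obtain \<zeta> where "ladder_system \<zeta>" using exists_ladder_system by blast
  then obtain d0 :: "(idx \<Rightarrow> 'v \<times> 'e list \<Rightarrow> 'k) \<Rightarrow> idx \<Rightarrow> 'v \<times> 'e list \<Rightarrow> 'k"
    where "presentation src tgt w es \<zeta> d0"
    using exists_boundary[of \<zeta>, where 'k = 'k] ray_quiver_axioms
    unfolding presentation_def presentation_axioms_def by blast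
  then interpret presentation src tgt w es \<zeta> d0 .
  obtain enc :: "(idx \<Rightarrow> 'v \<times> 'e list \<Rightarrow> 'k) \<Rightarrow> ('v \<times> 'e list \<times> nat set) set" where "inj enc"
    using exists_encoding[OF assms(1)] by blast
  then show ?thesis
    using counterexample[OF _ assms(1) countable_paths_ending_in \<open>UP\<close>] assms(3) w by blast
qed

end
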